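(* Let $\mathcal{S}=\{s_1<s_2<\cdots\}$ be either the set $\mathcal{P}$ of primes or the set $2\mathcal{Q}=\{a^2+b^2 : a,b\in\mathbb{Z}\}$ of sums of two squares. Let $S(x)=|\mathcal{S}\cap[1,x]|$ and $f(x)=x/S(x)$. Then: (S1) $f(x)\to\infty$ as $x\to\infty$. (S2) For every fixed $h$, the number of $s_k\leq x$ satisfying $s_{k+2}-s_k\leq h$ is $o_h(S(x)/\log f(x))$ as $x\to\infty$. Moreover, let $\iota>0$ (arbitrarily small) and let $(\delta_n)_{n\geq 1}$ be a sequence of positive real numbers satisfying $\delta_n\leq (s_{n+1}-s_{n-1})/2$ for all $n\geq 2$ and $\delta_n\gg \min\bigl((s_{n+1}-s_{n-1})/2,(\log\log n)^{\iota}\bigr)$ for all $n\geq 3$. Then: (D1) $\delta_n\geq 2$ for all but $o(x)$ integers $n\leq x$, as $x\to\infty$. (D2) There exists an integer $\ell\geq 1$ such that $\sum_{s_k\leq x}\prod_{i=0}^{\ell-1}\delta_{k+i}^{-1}=o(S(x)/\log f(x))$ as $x\to\infty$. (D3) $1\leq\delta_n\leq (s_{n+1}-s_{n-1})/2$ for all $n\geq 2$.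
   Context: The elements of $\mathcal{S}$ are enumerated in increasing order as $s_1<s_2<\cdots$. The notation $o_h$ means that the rate of decay may depend on $h$. The notation $u_n\gg v_n$ means that there is a constant $c>0$ such that $u_n\geq c\,v_n$ for all $n$ in the stated range.
   Formalization: In (D3) the lower bound 1 ≤ δ_n is replaced by c ≤ δ_n for some constant c > 0 depending on the sequence; the bound 1 does not follow, e.g. δ_1 = δ_2 = 1 and δ_n = ½·min((s_{n+1}−s_{n−1})/2, log log n) for n ≥ 3 gives δ_3 < 1. *)

theory Defs
  imports
    "HOL-Analysis.Analysis"
    "HOL-Library.Infinite_Set"
    "HOL-Library.Landau_Symbols"
    "HOL-Computational_Algebra.Primes"
begin

definition primes :: "nat set" where
  "primes = {p. prime p}"

(* Contains 0 = 0^2 + 0^2. *)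
definition sums_of_two_squares :: "nat set" where
  "sums_of_two_squares = {n. \<exists>a b :: int. int n = a\<^sup>2 + b\<^sup>2}"

(* For k >= 1 this is s_k: enumerate counts from 0, the elements s_1 < s_2 < ... from 1.
   The value at k = 0 is meaningless.  Real-valued, so that differences do not truncate. *)
definition nth_element :: "nat set \<Rightarrow> nat \<Rightarrow> real" where
  "nth_element S k = real (enumerate S (k - 1))"

definition counting :: "nat set \<Rightarrow> real \<Rightarrow> real" where
  "counting S x = real (card {s \<in> S. 1 \<le> real s \<and> real s \<le> x})"

definition mean_spacing :: "nat set \<Rightarrow> real \<Rightarrow> real" where
  "mean_spacing S x = x / counting S x"

(* (s_{n+1} - s_{n-1}) / 2, meaningful for n >= 2.  It is always at least 1, so any sequence with
   half_gap S n >= delta n >= c * min (half_gap S n) ((ln (ln n)) powr iota) for n >= 3 (some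
   c > 0) and delta 2 > 0 is bounded below by a positive constant on n >= 2.  That constant
   cannot be taken to be 1: c may be small, (ln (ln n)) powr iota < 1 for small n, and delta 2
   is any positive number up to half_gap S 2. *)
definition half_gap :: "nat set \<Rightarrow> nat \<Rightarrow> real" where
  "half_gap S n = (nth_element S (n + 1) - nth_element S (n - 1)) / 2"

end

theory Submission
  imports Defs "HOL-Number_Theory.Number_Theory" "HOL-Real_Asymp.Real_Asymp"
begin

text \<open>
  Both sets share two features, and everything else is deduced from these two alone.

  First, if \<open>n\<close> lies in the set and \<open>p < n\<close> is a prime with \<open>p mod 4 = 3\<close>, then \<open>p\<close> does not
  divide \<open>n\<close> exactly once: a prime \<open>n\<close> has no such divisor at all, and in a sum of two squares every
  prime that is 3 modulo 4 occurs to an even power.  For each \<open>p\<close> this forbids \<open>p - 1\<close> of the residue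
  classes modulo \<open>p\<^sup>2\<close>.  Second, the set is not too thin: \<open>S(x) \<ge> c x / ln x\<close> for large \<open>x\<close>.  For
  sums of two squares this is far from the true order \<open>x / sqrt (ln x)\<close>, but it follows from an
  elementary count of coincidences \<open>a\<^sup>2 + b\<^sup>2 = c\<^sup>2 + d\<^sup>2\<close> and the Cauchy-Schwarz inequality.

  That loss is affordable because gaps are taken over two steps, so that three consecutive
  elements enter.  If \<open>n\<close>,
  \<open>n + a\<close> and \<open>n + b\<close> with \<open>0 < a < b\<close> all lie in \<open>S\<close>, then every prime \<open>p > b\<close> that is 3 modulo 4
  forbids \<open>3 (p - 1)\<close> classes modulo \<open>p\<^sup>2\<close>.  As these primes make up half of all primes on the
  logarithmic scale, a sieve up to \<open>z\<close> leaves a proportion of roughly \<open>(ln z) powr (-3/2)\<close>, which beats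
  the density \<open>1 / ln x\<close> by a power of \<open>ln x\<close>.  So there is room to spare: Brun's pure sieve
  (\<open>brun_pure_sieve\<close>), with \<open>ln z\<close> of size \<open>ln x / ln (ln x)\<close>, is strong enough, and so is
  the bound \<open>0.46 ln (ln z)\<close> from below for the sum of the reciprocals of the primes in question
  (\<open>mertens_primes_3_mod_4\<close>), whose true size is \<open>0.5 ln (ln z)\<close>.  The outcome is
  \<open>few_close_triples\<close>: for large \<open>x\<close>, at most \<open>x / ln x powr (6/5)\<close> elements up to \<open>x\<close> are followed by two more
  elements within distance \<open>ln (ln x)\<close>.

  Write \<open>f(x)\<close> for the mean spacing \<open>x / S(x)\<close>.  The lower bound for \<open>S(x)\<close> gives \<open>f(x) \<le> (ln x)\<^sup>2\<close>,
  hence \<open>ln (f(x)) \<le> 2 ln (ln x)\<close>, and close triples are as rare as claimed.  As two-step gaps longer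
  than \<open>ln (ln x)\<close> can occur at most \<open>2 x / ln (ln x)\<close> times below \<open>x\<close>, the same estimate gives
  \<open>S(x) = O(x / ln (ln x))\<close>, so \<open>f\<close> tends to infinity.  For large \<open>n\<close>, \<open>\<delta> n < 2\<close> forces a bounded
  two-step gap, so it is rare.  In the sum of the products of \<open>\<delta>\<close>, away from few exceptional \<open>k\<close> all
  factors \<open>\<delta> (k + i)\<close> are at least a constant times a fixed power of \<open>ln (ln x)\<close>, so a product of
  sufficiently many reciprocals saves \<open>(ln (ln x))\<^sup>2\<close>; the exceptional \<open>k\<close> are few by
  \<open>few_close_triples\<close>, and their products are bounded.  That \<open>\<delta>\<close> stays above a positive constant holds
  because a half gap is at least 1 and \<open>ln (ln 3)\<close> is positive.
\<close>

section \<open>Reciprocals of primes that are 3 modulo 4\<close>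

text \<open>
  The nonprincipal Dirichlet character modulo 4.
\<close>
definition chi4 :: "nat \<Rightarrow> real" where
  "chi4 n = (if n mod 4 = 1 then 1 else if n mod 4 = 3 then - 1 else 0)"

lemma chi4_mult: "chi4 (m * n) = chi4 m * chi4 n"
proof -
  have "m mod 4 \<in> {0,1,2,3}" "n mod 4 \<in> {0,1,2,3}" by auto
  moreover have "m * n mod 4 = (m mod 4) * (n mod 4) mod 4" by (simp add: mod_mult_eq)
  ultimately show ?thesis
    unfolding chi4_def by auto
qed

text \<open>
  The partial sums of the character are 0 or 1, so summation by parts bounds the series by its first
  term.  Applied to \<open>n powr (- s)\<close> this gives \<open>L(s) \<le> 1\<close>.  An upper bound for the L-function is what makes
  primes that are 3 modulo 4 abundant, as they are the ones at which the character is negative.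
\<close>
lemma sum_chi4_decreasing_le:
  fixes a :: "nat \<Rightarrow> real"
  assumes dec: "\<And>n. n \<ge> 1 \<Longrightarrow> a (Suc n) \<le> a n" and nonneg: "\<And>n. n \<ge> 1 \<Longrightarrow> 0 \<le> a n"
  shows "(\<Sum>n=1..N. chi4 n * a n) \<le> a 1"
proof -
  define X where "X N = (if N mod 4 \<in> {1,2} then 1 else 0 :: real)" for N :: nat
  have "(\<Sum>n=1..N. chi4 n * a n) \<le> a 1 - (1 - X N) * a (Suc N)"
  proof (induction N)
    case (Suc N)
    have step: "X (Suc N) = X N + chi4 (Suc N)" "X (Suc N) \<in> {0, 1}"
    proof -
      have "N mod 4 \<in> {0,1,2,3}" by auto
      then show "X (Suc N) = X N + chi4 (Suc N)"
        unfolding X_def chi4_def by (auto simp: mod_Suc)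
    qed (simp add: X_def)
    have "(1 - X (Suc N)) * a (Suc (Suc N)) \<le> (1 - X (Suc N)) * a (Suc N)"
      using step(2) dec[of "Suc N"] by (intro mult_left_mono) auto
    then show ?case using Suc.IH step(1) by (simp add: algebra_simps)
  qed (simp add: X_def)
  moreover have "0 \<le> (1 - X N) * a (Suc N)"
    using nonneg[of "Suc N"] by (simp add: X_def)
  ultimately show ?thesis by linarith
qed

definition smooth_numbers :: "nat set \<Rightarrow> nat set" where
  "smooth_numbers P = {n. n > 0 \<and> prime_factors n \<subseteq> P}"

text \<open>
  Euler product over finitely many primes.  Adding a prime \<open>p\<close> splits the new set of smooth numbers
  into the old one and the multiples of \<open>p\<close>, and the latter are \<open>p\<close> times the whole new set.  Hence the
  new sum \<open>x\<close> satisfies \<open>x = old + f p * x\<close>.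
\<close>
lemma infsum_smooth_numbers:
  fixes f :: "nat \<Rightarrow> real"
  assumes one: "f 1 = 1" and mult: "\<And>m n. f (m * n) = f m * f n"
    and summ: "f summable_on UNIV" and small: "\<And>p. prime p \<Longrightarrow> \<bar>f p\<bar> < 1"
    and "finite P" and "\<And>p. p \<in> P \<Longrightarrow> prime p"
  shows "infsum f (smooth_numbers P) = (\<Prod>p\<in>P. 1 / (1 - f p))"
  using \<open>finite P\<close> \<open>\<And>p. p \<in> P \<Longrightarrow> prime p\<close>
proof (induction P)
  case empty
  have "smooth_numbers {} = {1}"
    by (auto simp: smooth_numbers_def prime_factorization_empty_iff set_mset_eq_empty_iff)
  then show ?case using one by simp
next
  case (insert p P)
  let ?N = "smooth_numbers P" and ?N' = "smooth_numbers (insert p P)"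
  have p: "prime p" and P: "\<And>q. q \<in> P \<Longrightarrow> prime q" using insert.prems by auto
  have split: "?N' = ?N \<union> (\<lambda>n. p * n) ` ?N'"
  proof (intro equalityI subsetI)
    fix n assume n: "n \<in> ?N'"
    show "n \<in> ?N \<union> (\<lambda>n. p * n) ` ?N'"
    proof (cases "p dvd n")
      case True
      then obtain m where m: "n = p * m" by auto
      have "m > 0" "prime_factors m \<subseteq> prime_factors n"
        using n m by (auto simp: smooth_numbers_def dvd_prime_factors)
      then show ?thesis using n m by (auto simp: smooth_numbers_def)
    next
      case False
      then show ?thesis using n by (auto simp: smooth_numbers_def prime_factors_dvd)
    qed
  next
    fix n assume "n \<in> ?N \<union> (\<lambda>n. p * n) ` ?N'"
    then show "n \<in> ?N'"
      using p by (auto simp: smooth_numbers_def prime_factors_product prime_prime_factors prime_gt_0_nat)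
  qed
  have disj: "?N \<inter> (\<lambda>n. p * n) ` ?N' = {}"
    using insert.hyps p by (auto simp: smooth_numbers_def prime_factors_product prime_prime_factors prime_gt_0_nat)
  have inj: "inj_on (\<lambda>n. p * n) ?N'" using p by (auto simp: inj_on_def)
  have s: "f summable_on A" for A by (rule summable_on_subset_banach[OF summ]) auto
  define x where "x = infsum f ?N'"
  have img: "infsum f ((\<lambda>n. p * n) ` ?N') = f p * x"
    by (simp add: infsum_reindex[OF inj] o_def mult infsum_cmult_right' x_def)
  have "x = infsum f ?N + infsum f ((\<lambda>n. p * n) ` ?N')"
    unfolding x_def by (subst split, intro infsum_Un_disjoint s disj)
  then have "x - f p * x = infsum f ?N" unfolding img by linarith
  then have "x * (1 - f p) = infsum f ?N" by (simp add: right_diff_distrib mult.commute)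
  moreover have "1 - f p \<noteq> 0" using small[OF p] by auto
  ultimately have "x = infsum f ?N * (1 / (1 - f p))" by (metis nonzero_eq_divide_eq times_divide_eq_right mult.right_neutral)
  then show ?case using insert P by (simp add: x_def mult.commute)
qed

text \<open>
  The mean value theorem for \<open>t powr (- \<sigma>)\<close> on \<open>[n, n + 1]\<close>; both inequalities telescope and compare
  sums of \<open>n powr (- 1 - \<sigma>)\<close> with the corresponding integrals.
\<close>
lemma powr_diff_le:
  fixes \<sigma> :: real assumes "\<sigma> > 0" "n \<ge> 1"
  shows "(real n powr - \<sigma> - (real n + 1) powr - \<sigma>) / \<sigma> \<le> real n powr (- 1 - \<sigma>)"
   and "(real n + 1) powr (- 1 - \<sigma>) \<le> (real n powr - \<sigma> - (real n + 1) powr - \<sigma>) / \<sigma>"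
proof -
  have "\<exists>t. real n < t \<and> t < real n + 1 \<and>
     (real n + 1) powr - \<sigma> - real n powr - \<sigma> = (real n + 1 - real n) * (- \<sigma> * t powr (- \<sigma> - 1))"
    using assms by (intro MVT2) (auto intro!: derivative_eq_intros simp: field_simps)
  then obtain t where t: "real n < t" "t < real n + 1"
     "(real n + 1) powr - \<sigma> - real n powr - \<sigma> = - \<sigma> * t powr (- \<sigma> - 1)" by auto
  have eq: "(real n powr - \<sigma> - (real n + 1) powr - \<sigma>) / \<sigma> = t powr (- 1 - \<sigma>)"
    using t(3) assms by (simp add: field_simps minus_diff_commute)
  show "(real n powr - \<sigma> - (real n + 1) powr - \<sigma>) / \<sigma> \<le> real n powr (- 1 - \<sigma>)"
    unfolding eq using assms t by (intro powr_mono2') auto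
  show "(real n + 1) powr (- 1 - \<sigma>) \<le> (real n powr - \<sigma> - (real n + 1) powr - \<sigma>) / \<sigma>"
    unfolding eq using assms t by (intro powr_mono2') auto
qed

lemma sum_powr_lower:
  fixes \<sigma> :: real assumes "\<sigma> > 0"
  shows "(1 - (real Z + 1) powr - \<sigma>) / \<sigma> \<le> (\<Sum>n=1..Z. real n powr (- 1 - \<sigma>))"
proof (induction Z)
  case (Suc Z)
  show ?case using Suc powr_diff_le(1)[OF assms, of "Suc Z"]
    by (simp add: diff_divide_distrib add.commute)
qed auto

lemma summable_on_powr:
  fixes \<sigma> :: real assumes "\<sigma> > 0"
  shows "(\<lambda>n::nat. real n powr (- 1 - \<sigma>)) summable_on UNIV"
  using assms by (intro norm_summable_imp_summable_on) (auto simp: summable_real_powr_iff)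

lemma infsum_powr_tail:
  fixes \<sigma> :: real assumes "\<sigma> > 0" "Z \<ge> 1"
  shows "infsum (\<lambda>n::nat. real n powr (- 1 - \<sigma>)) {Z<..} \<le> real Z powr - \<sigma> / \<sigma>"
proof (rule infsum_le_finite_sums)
  show "(\<lambda>n::nat. real n powr (- 1 - \<sigma>)) summable_on {Z<..}"
    by (rule summable_on_subset_banach[OF summable_on_powr[OF assms(1)]]) auto
  fix F assume F: "finite F" "F \<subseteq> {Z<..}"
  have le: "(\<Sum>n\<in>{Z<..M}. real n powr (- 1 - \<sigma>)) \<le> (real Z powr - \<sigma> - real M powr - \<sigma>) / \<sigma>"
    if "Z \<le> M" for M using that
  proof (induction M rule: dec_induct)
    case (step M)
    have "{Z<..Suc M} = insert (Suc M) {Z<..M}" using step by auto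
    then show ?case using step powr_diff_le(2)[OF assms(1), of M] assms
      by (simp add: diff_divide_distrib add.commute)
  qed auto
  obtain M where M: "F \<subseteq> {..M}" using F(1) finite_nat_iff_bounded_le by auto
  have "(\<Sum>n\<in>F. real n powr (- 1 - \<sigma>)) \<le> (\<Sum>n\<in>{Z<..max M Z}. real n powr (- 1 - \<sigma>))"
    using F M by (intro sum_mono2) (auto simp: le_max_iff_disj)
  also have "\<dots> \<le> (real Z powr - \<sigma> - real (max M Z) powr - \<sigma>) / \<sigma>" by (rule le) simp
  also have "\<dots> \<le> real Z powr - \<sigma> / \<sigma>" using assms by (simp add: divide_right_mono)
  finally show "(\<Sum>n\<in>F. real n powr (- 1 - \<sigma>)) \<le> real Z powr - \<sigma> / \<sigma>" .
qed

text \<open>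
  The quotient of the Euler products of \<open>\<zeta>(1 + \<sigma>)\<close> and \<open>L(1 + \<sigma>)\<close>, restricted to primes up to \<open>Z\<close>, is
  large: the first is at least the sum over \<open>n \<le> Z\<close>, the second is at most 1 plus the tail over
  \<open>n > Z\<close>.  Working at \<open>1 + \<sigma>\<close> rather than at 1 makes that tail absolutely convergent.
\<close>
lemma euler_product_ratio_bound:
  fixes \<sigma> :: real
  assumes \<sigma>: "0 < \<sigma>" and Z: "Z \<ge> 1"
  defines "t \<equiv> \<lambda>n::nat. real n powr (- 1 - \<sigma>)"
  shows "(1 - (real Z + 1) powr - \<sigma>) / \<sigma> \<le>
     (1 + real Z powr - \<sigma> / \<sigma>) *
       (\<Prod>p | prime p \<and> p \<le> Z. (1 - chi4 p * t p) / (1 - t p))"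
proof -
  define P where "P = {p. prime p \<and> p \<le> Z}"
  have fin: "finite P" and prime: "\<And>p. p \<in> P \<Longrightarrow> prime p" by (auto simp: P_def)
  have sum_t: "t summable_on A" for A
    unfolding t_def by (rule summable_on_subset_banach[OF summable_on_powr[OF \<sigma>]]) auto
  have t_nonneg: "0 \<le> t n" for n by (simp add: t_def)
  have t_small: "t p < 1" if "prime p" for p
    unfolding t_def using prime_gt_1_nat[OF that] \<sigma> powr_less_mono[of "- 1 - \<sigma>" 0 "real p"] by simp
  define f where "f n = chi4 n * t n" for n
  have f_le: "\<bar>f n\<bar> \<le> t n" for n using t_nonneg[of n] by (simp add: f_def chi4_def)
  have sum_f: "f summable_on A" for A
  proof -
    have "(\<lambda>n. norm (f n)) summable_on A"
      by (rule summable_on_comparison_test[OF sum_t]) (use f_le in auto)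
    then show ?thesis by (rule abs_summable_summable)
  qed
  have t_mult: "t (m * n) = t m * t n" for m n by (simp add: t_def powr_mult)
  have prod_t: "infsum t (smooth_numbers P) = (\<Prod>p\<in>P. 1 / (1 - t p))"
    by (intro infsum_smooth_numbers t_mult sum_t fin) (use t_nonneg t_small prime in \<open>auto simp: t_def\<close>)
  have prod_f: "infsum f (smooth_numbers P) = (\<Prod>p\<in>P. 1 / (1 - f p))"
    by (intro infsum_smooth_numbers sum_f fin)
       (use t_small prime f_le in \<open>auto simp: f_def t_mult chi4_mult intro: le_less_trans\<close>, auto simp: t_def chi4_def)
  have sub: "{1..Z} \<subseteq> smooth_numbers P"
  proof
    fix n assume n: "n \<in> {1..Z}"
    have "p \<le> Z" if "p \<in> prime_factors n" for p
      using n that dvd_imp_le[of p n] by (auto simp: prime_factors_dvd)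
    then show "n \<in> smooth_numbers P"
      using n by (auto simp: smooth_numbers_def P_def)
  qed
  have "(1 - (real Z + 1) powr - \<sigma>) / \<sigma> \<le> (\<Sum>n=1..Z. t n)"
    unfolding t_def by (rule sum_powr_lower[OF \<sigma>])
  also have "\<dots> \<le> infsum t (smooth_numbers P)"
    by (rule finite_sum_le_infsum) (use sub sum_t t_nonneg in auto)
  finally have A: "(1 - (real Z + 1) powr - \<sigma>) / \<sigma> \<le> (\<Prod>p\<in>P. 1 / (1 - t p))" unfolding prod_t .
  let ?R = "smooth_numbers P - {1..Z}"
  have "infsum f (smooth_numbers P) = infsum f ({1..Z} \<union> ?R)" using sub by (simp add: Un_absorb1)
  also have "\<dots> = (\<Sum>n=1..Z. f n) + infsum f ?R"
    by (subst infsum_Un_disjoint) (use sum_f in auto)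
  also have "(\<Sum>n=1..Z. f n) \<le> t 1"
    unfolding f_def by (rule sum_chi4_decreasing_le)
       (use \<sigma> in \<open>auto simp: t_def intro!: powr_mono2'\<close>)
  also have "t 1 = 1" by (simp add: t_def)
  also have "infsum f ?R \<le> infsum t ?R"
    by (intro infsum_mono sum_f sum_t) (use f_le abs_le_D1 in blast)
  also have "\<dots> \<le> infsum t {Z<..}"
    by (rule infsum_mono_neutral) (use sum_t t_nonneg in \<open>auto simp: smooth_numbers_def\<close>)
  also have "\<dots> \<le> real Z powr - \<sigma> / \<sigma>"
    unfolding t_def by (rule infsum_powr_tail[OF \<sigma> Z])
  finally have B: "(\<Prod>p\<in>P. 1 / (1 - f p)) \<le> 1 + real Z powr - \<sigma> / \<sigma>" unfolding prod_f by simp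
  have f_lt: "f p < 1" if "p \<in> P" for p
    using f_le[of p] t_small[OF prime[OF that]] by auto
  have nn: "0 \<le> (\<Prod>p\<in>P. (1 - f p) / (1 - t p))"
    by (intro prod_nonneg) (use f_lt t_small prime in \<open>force simp: less_imp_le\<close>)
  have "(\<Prod>p\<in>P. 1 / (1 - t p)) = (\<Prod>p\<in>P. (1 / (1 - f p)) * ((1 - f p) / (1 - t p)))"
    using f_lt by (intro prod.cong) (auto simp: field_simps dest: order_less_imp_not_eq)
  also have "\<dots> = (\<Prod>p\<in>P. 1 / (1 - f p)) * (\<Prod>p\<in>P. (1 - f p) / (1 - t p))"
    by (rule prod.distrib)
  also have "\<dots> \<le> (1 + real Z powr - \<sigma> / \<sigma>) * (\<Prod>p\<in>P. (1 - f p) / (1 - t p))"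
    by (rule mult_right_mono[OF B nn])
  finally show ?thesis using A unfolding P_def f_def by simp
qed

lemma sum_inverse_squares_le:
  "(\<Sum>n=2..N. 1 / (real n)\<^sup>2) \<le> 1 - 1 / real (max 1 N)"
proof (induction N)
  case (Suc N)
  show ?case
  proof (cases "N \<ge> 1")
    case True
    have "1 / (real (Suc N))\<^sup>2 \<le> 1 / (real N * real (Suc N))"
      using True by (intro divide_left_mono) (auto simp: power2_eq_square)
    also have "\<dots> = 1 / real N - 1 / real (Suc N)" using True by (simp add: field_simps)
    finally show ?thesis using Suc True by (simp add: max_def)
  qed auto
qed auto

lemma sum_inverse_squares_le_1:
  assumes "finite A" "\<And>n::nat. n \<in> A \<Longrightarrow> n \<ge> 2"
  shows "(\<Sum>n\<in>A. 1 / (real n)\<^sup>2) \<le> 1"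
proof -
  obtain N where N: "A \<subseteq> {..N}" using assms(1) finite_nat_iff_bounded_le by auto
  have "(\<Sum>n\<in>A. 1 / (real n)\<^sup>2) \<le> (\<Sum>n=2..N. 1 / (real n)\<^sup>2)"
    using N assms by (intro sum_mono2) auto
  also have "\<dots> \<le> 1 - 1 / real (max 1 N)" by (rule sum_inverse_squares_le)
  also have "\<dots> \<le> 1" by simp
  finally show ?thesis .
qed

text \<open>
  In the quotient of the two Euler products the primes that are 1 modulo 4 cancel, and each prime that
  is 3 modulo 4 contributes \<open>(1 + t) / (1 - t)\<close>, which is \<open>exp (2 t)\<close> up to a summable error.
\<close>
lemma euler_factor_ratio_le:
  fixes \<sigma> :: real
  assumes "0 < \<sigma>" and p: "prime p"
  defines "t \<equiv> real p powr (- 1 - \<sigma>)"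
  shows "(1 - chi4 p * t) / (1 - t) \<le>
    (if p = 2 then 2 else if p mod 4 = 3 then exp (2 / real p + 2 * (1 / (real p)\<^sup>2)) else 1)"
proof -
  have p2: "p \<ge> 2" using p by (rule prime_ge_2_nat)
  have t0: "0 < t" using p2 by (simp add: t_def)
  have tp: "t \<le> 1 / real p"
  proof -
    have "t \<le> real p powr - 1" unfolding t_def using p2 assms(1) by (intro powr_mono) auto
    then show ?thesis using p2 by (simp add: powr_minus_divide)
  qed
  consider "p = 2" | "p mod 4 = 1" | "p mod 4 = 3" "p \<noteq> 2"
  proof -
    have "p mod 4 \<in> {0,1,2,3}" by auto
    moreover have "p mod 4 \<noteq> 0" "p mod 4 = 2 \<Longrightarrow> p = 2"
    proof -
      show "p mod 4 \<noteq> 0"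
      proof
        assume "p mod 4 = 0"
        then have "2 dvd p" "4 dvd p" by presburger+
        then have "p = 2" using p primes_dvd_imp_eq two_is_prime_nat by blast
        then show False using \<open>4 dvd p\<close> by simp
      qed
      show "p = 2" if "p mod 4 = 2"
      proof -
        have "even p" using that by presburger
        then show ?thesis using p primes_dvd_imp_eq two_is_prime_nat by blast
      qed
    qed
    ultimately show ?thesis using that by fastforce
  qed
  then show ?thesis
  proof cases
    case 1
    then have "t \<le> 1/2" using tp by simp
    then have "1 / (1 - t) \<le> 2" by (simp add: field_simps)
    then show ?thesis using 1 by (simp add: chi4_def)
  next
    case 2
    have "1 / real p < 1" using p2 by simp
    then have "t < 1" using tp by linarith
    then show ?thesis using 2 by (auto simp: chi4_def)
  next
    case 3
    then have p3: "p \<ge> 3" using p2 by simp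
    have t3: "t \<le> 1/3" 
    proof -
      have "1 / real p \<le> 1 / 3" using p3 by (intro divide_left_mono) auto
      then show ?thesis using tp by linarith
    qed
    have "(1 + t) / (1 - t) = (1 + t) * (1 + t / (1 - t))" using t3 by (simp add: field_simps)
    also have "\<dots> \<le> exp t * exp (t / (1 - t))"
      using t0 t3 by (intro mult_mono exp_ge_add_one_self) auto
    also have "\<dots> = exp (t + t / (1 - t))" by (simp add: exp_add)
    also have "\<dots> \<le> exp (2 / real p + 2 * (1 / (real p)\<^sup>2))"
    proof -
      have "t / (1 - t) \<le> t + 2 * t\<^sup>2"
      proof -
        have "0 \<le> t\<^sup>2 * (1 - 2 * t)" using t3 t0 by (intro mult_nonneg_nonneg) auto
        then have "t \<le> (t + 2 * t\<^sup>2) * (1 - t)" by (simp add: algebra_simps power2_eq_square)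
        then show ?thesis using t3 by (simp add: pos_divide_le_eq)
      qed
      moreover have "t\<^sup>2 \<le> (1 / real p)\<^sup>2" using tp t0 by (intro power_mono) auto
      ultimately show ?thesis using tp by (simp add: power_divide)
    qed
    finally show ?thesis using 3 by (simp add: chi4_def)
  qed
qed

lemma sum_inverse_primes_3_mod_4_ge:
  fixes \<sigma> :: real
  assumes \<sigma>: "0 < \<sigma>" and Z: "Z \<ge> 1"
  shows "(1 - (real Z + 1) powr - \<sigma>) / \<sigma> \<le>
     (1 + real Z powr - \<sigma> / \<sigma>) *
       (2 * exp (2 * (\<Sum>p | prime p \<and> p mod 4 = 3 \<and> p \<le> Z. 1 / real p) + 2))"
proof -
  let ?t = "\<lambda>p::nat. real p powr (- 1 - \<sigma>)"
  let ?e = "\<lambda>p::nat. if p mod 4 = 3 then exp (2 / real p + 2 * (1 / (real p)\<^sup>2)) else 1"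
  define P where "P = {p. prime p \<and> p \<le> Z}"
  define Q where "Q = {p. prime p \<and> p mod 4 = 3 \<and> p \<le> Z}"
  have fin: "finite P" "finite Q" by (auto simp: P_def Q_def)
  have t1: "0 \<le> (1 - chi4 p * ?t p) / (1 - ?t p)" if "p \<in> P" for p
  proof -
    have "?t p < 1"
      using that prime_gt_1_nat[of p] \<sigma> powr_less_mono[of "- 1 - \<sigma>" 0 "real p"] by (simp add: P_def)
    then show ?thesis by (auto simp: chi4_def)
  qed
  have "(\<Prod>p\<in>P. (1 - chi4 p * ?t p) / (1 - ?t p)) \<le> (\<Prod>p\<in>P. (if p = 2 then 2 else 1) * ?e p)"
  proof (rule prod_mono, safe)
    fix p assume "p \<in> P"
    then show "0 \<le> (1 - chi4 p * ?t p) / (1 - ?t p)" by (rule t1)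
    have "prime p" using \<open>p \<in> P\<close> by (simp add: P_def)
    from euler_factor_ratio_le[OF \<sigma> this]
    show "(1 - chi4 p * ?t p) / (1 - ?t p) \<le> (if p = 2 then 2 else 1) * ?e p"
      by (auto split: if_splits)
  qed
  also have "\<dots> = (\<Prod>p\<in>P. if p = 2 then 2 else 1) * (\<Prod>p\<in>P. ?e p)" by (rule prod.distrib)
  also have "\<dots> \<le> 2 * (\<Prod>p\<in>P. ?e p)"
    using fin by (intro mult_right_mono prod_nonneg) (auto simp: prod.delta)
  also have "(\<Prod>p\<in>P. ?e p) = (\<Prod>p\<in>Q. exp (2 / real p + 2 * (1 / (real p)\<^sup>2)))"
  proof -
    have "Q = {p \<in> P. p mod 4 = 3}" by (auto simp: P_def Q_def)
    then show ?thesis using fin by (simp only: prod.inter_filter)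
  qed
  also have "\<dots> = exp (2 * (\<Sum>p\<in>Q. 1 / real p) + 2 * (\<Sum>p\<in>Q. 1 / (real p)\<^sup>2))"
    using fin by (simp add: exp_sum[symmetric] sum.distrib sum_distrib_left)
  finally have *: "(\<Prod>p\<in>P. (1 - chi4 p * ?t p) / (1 - ?t p)) \<le>
      2 * exp (2 * (\<Sum>p\<in>Q. 1 / real p) + 2 * (\<Sum>p\<in>Q. 1 / (real p)\<^sup>2))" .
  have "(\<Sum>p\<in>Q. 1 / (real p)\<^sup>2) \<le> 1"
    using sum_inverse_squares_le_1[of Q] fin prime_ge_2_nat by (auto simp: Q_def)
  then have "2 * exp (2 * (\<Sum>p\<in>Q. 1 / real p) + 2 * (\<Sum>p\<in>Q. 1 / (real p)\<^sup>2))
      \<le> 2 * exp (2 * (\<Sum>p\<in>Q. 1 / real p) + 2)" by simp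
  with * have *: "(\<Prod>p\<in>P. (1 - chi4 p * ?t p) / (1 - ?t p)) \<le> 2 * exp (2 * (\<Sum>p\<in>Q. 1 / real p) + 2)"
    by (rule order_trans)
  have "0 \<le> 1 + real Z powr - \<sigma> / \<sigma>" using \<sigma> by (simp add: add_nonneg_nonneg)
  from mult_left_mono[OF * this] euler_product_ratio_bound[OF \<sigma> Z]
  show ?thesis unfolding P_def Q_def by linarith
qed

text \<open>
  The expected constant is 1/2.  The choice \<open>\<sigma> = 2 ln (ln Z) / ln Z\<close> makes the tail
  \<open>Z powr (- \<sigma>) / \<sigma>\<close> at most 1, and costs only a term of order \<open>ln (ln (ln Z))\<close> in \<open>ln (1 / \<sigma>)\<close>.  That
  term is absorbed by lowering 1/2 to 23/50; any constant above 1/3 would do for the sieve.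
\<close>
lemma mertens_primes_3_mod_4:
  "eventually (\<lambda>Z::nat. (23/50) * ln (ln (real Z)) \<le>
      (\<Sum>p | prime p \<and> p mod 4 = 3 \<and> p \<le> Z. 1 / real p)) sequentially"
proof -
  define s where "s z = 2 * ln (ln z) / ln z" for z :: real
  have "eventually (\<lambda>z::real. z \<ge> 1 \<and> s z > 0 \<and> z powr - s z / s z \<le> 1 \<and> (z + 1) powr - s z / s z \<le> 1 \<and>
     exp ((23/25) * ln (ln z)) \<le> (1 / s z - 1) / (4 * exp 2)) at_top"
    unfolding s_def by (intro eventually_conj; real_asymp)
  from eventually_nat_real[OF this] show ?thesis
  proof eventually_elim
    case (elim Z)
    let ?S = "\<Sum>p | prime p \<and> p mod 4 = 3 \<and> p \<le> Z. 1 / real p"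
    have Z: "Z \<ge> 1" using elim by simp
    have "1 / s Z - 1 \<le> (1 - (real Z + 1) powr - s Z) / s Z"
      using elim by (simp add: diff_divide_distrib)
    also have "\<dots> \<le> (1 + real Z powr - s Z / s Z) * (2 * exp (2 * ?S + 2))"
      using elim Z by (intro sum_inverse_primes_3_mod_4_ge) auto
    also have "\<dots> \<le> 2 * (2 * exp (2 * ?S + 2))"
      using elim by (intro mult_right_mono) auto
    also have "\<dots> = exp (2 * ?S) * (4 * exp 2)" by (simp add: exp_add)
    finally have "(1 / s Z - 1) / (4 * exp 2) \<le> exp (2 * ?S)" by (simp add: pos_divide_le_eq)
    then have "exp ((23/25) * ln (ln (real Z))) \<le> exp (2 * ?S)" using elim by linarith
    then show ?case by simp
  qed
qed

section \<open>Brun's pure sieve\<close>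
lemma card_residue_class_bound:
  fixes N Q r :: nat
  assumes "Q > 0"
  shows "\<bar>real (card {n. n < N \<and> [n = r] (mod Q)}) - real N / real Q\<bar> \<le> 1"
proof -
  define s where "s = r mod Q"
  have s: "s < Q" using assms by (simp add: s_def)
  define m where "m = nat \<lceil>(real N - real s) / real Q\<rceil>"
  have m: "Q * k + s < N \<longleftrightarrow> k < m" for k
  proof -
    have "k < m \<longleftrightarrow> real k < (real N - real s) / real Q"
      unfolding m_def by (simp add: zless_nat_conj zless_nat_eq_int_zless less_ceiling_iff)
    also have "\<dots> \<longleftrightarrow> real (Q * k + s) < real N"
      using assms by (simp add: field_simps)
    finally show ?thesis unfolding of_nat_less_iff by blast
  qed
  have "{n. n < N \<and> [n = r] (mod Q)} = (\<lambda>k. Q * k + s) ` {..<m}"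
  proof (intro equalityI subsetI)
    fix n assume "n \<in> {n. n < N \<and> [n = r] (mod Q)}"
    then have "n < N" "n mod Q = s" by (simp_all add: cong_def s_def)
    then have "n < N" "n = Q * (n div Q) + s" by (metis mult_div_mod_eq)+
    then show "n \<in> (\<lambda>k. Q * k + s) ` {..<m}" using m by (metis imageI lessThan_iff)
  next
    fix n assume "n \<in> (\<lambda>k. Q * k + s) ` {..<m}"
    then obtain k where "k < m" "n = Q * k + s" by blast
    then show "n \<in> {n. n < N \<and> [n = r] (mod Q)}" using m[of k] by (simp add: cong_def s_def)
  qed
  then have "card {n. n < N \<and> [n = r] (mod Q)} = m"
    using assms by (simp add: card_image inj_on_def)
  moreover have "(real N - real s) / real Q > real N / real Q - 1" "(real N - real s) / real Q \<le> real N / real Q"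
    using s assms by (auto simp: field_simps)
  moreover have "real N / real Q \<ge> 0" by simp
  ultimately show ?thesis unfolding m_def by linarith
qed

text \<open>
  The progression modulo \<open>Q\<close> is carried along so that the induction can absorb one modulus at a time:
  fixing the residue modulo \<open>q p\<close> turns a class modulo \<open>Q\<close> into one modulo \<open>Q * q p\<close>.  The errors
  simply add up over the chosen residues.
\<close>
lemma card_residues_in_progression:
  fixes q :: "'a \<Rightarrow> nat" and F :: "'a \<Rightarrow> nat set"
  assumes "finite D" "\<And>p. p \<in> D \<Longrightarrow> q p > 0" "\<And>p. p \<in> D \<Longrightarrow> F p \<subseteq> {..<q p}"
    and "\<And>p p'. p \<in> D \<Longrightarrow> p' \<in> D \<Longrightarrow> p \<noteq> p' \<Longrightarrow> coprime (q p) (q p')"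
    and "Q > 0" "\<And>p. p \<in> D \<Longrightarrow> coprime Q (q p)"
  shows "\<bar>real (card {n. n < N \<and> [n = r] (mod Q) \<and> (\<forall>p\<in>D. n mod q p \<in> F p)})
           - real N / real Q * (\<Prod>p\<in>D. real (card (F p)) / real (q p))\<bar> \<le> (\<Prod>p\<in>D. real (card (F p)))"
  using assms
proof (induction D arbitrary: Q r)
  case empty
  then show ?case using card_residue_class_bound[of Q N r] by simp
next
  case (insert p D)
  have q: "q p > 0" and F: "F p \<subseteq> {..<q p}" and cop: "coprime Q (q p)" using insert.prems by auto
  have finF: "finite (F p)" using F finite_subset by blast
  have "\<exists>x. [x = r] (mod Q) \<and> [x = f] (mod q p)" for f
    by (rule binary_chinese_remainder_nat[OF cop])
  then obtain x where x: "\<And>f. [x f = r] (mod Q)" "\<And>f. [x f = f] (mod q p)" by metis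
  have iff: "[n = x f] (mod Q * q p) \<longleftrightarrow> [n = r] (mod Q) \<and> n mod q p = f" if "f \<in> F p" for n f
  proof -
    have "f < q p" using that F by auto
    then have "n mod q p = f \<longleftrightarrow> [n = f] (mod q p)" by (simp add: cong_def)
    moreover have "[n = x f] (mod Q * q p) \<longleftrightarrow> [n = x f] (mod Q) \<and> [n = x f] (mod q p)"
      using cop by (metis coprime_cong_mult_nat cong_modulus_mult_nat mult.commute)
    ultimately show ?thesis using x by (metis cong_sym cong_trans)
  qed
  define A where "A f = {n. n < N \<and> [n = x f] (mod Q * q p) \<and> (\<forall>p\<in>D. n mod q p \<in> F p)}" for f
  let ?g = "\<Prod>p\<in>D. real (card (F p)) / real (q p)" and ?w = "\<Prod>p\<in>D. real (card (F p))"
  have "{n. n < N \<and> [n = r] (mod Q) \<and> (\<forall>p\<in>insert p D. n mod q p \<in> F p)} = (\<Union>f\<in>F p. A f)"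
    using iff by (auto simp: A_def)
  moreover have "card (\<Union>f\<in>F p. A f) = (\<Sum>f\<in>F p. card (A f))"
    by (rule card_UN_disjoint) (use finF iff in \<open>auto simp: A_def\<close>)
  ultimately have card: "card {n. n < N \<and> [n = r] (mod Q) \<and> (\<forall>p\<in>insert p D. n mod q p \<in> F p)}
      = (\<Sum>f\<in>F p. card (A f))" by simp
  have each: "\<bar>real (card (A f)) - real N / real (Q * q p) * ?g\<bar> \<le> ?w" for f
    unfolding A_def
  proof (rule insert.IH)
    show "Q * q p > 0" using insert.prems q by simp
    fix p' assume p': "p' \<in> D"
    then have "p \<noteq> p'" using insert.hyps by auto
    then have "coprime (q p) (q p')" using insert.prems p' by auto
    then show "coprime (Q * q p) (q p')" using insert.prems p' by simp
  qed (use insert.prems in auto)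
  have "\<bar>(\<Sum>f\<in>F p. real (card (A f))) - (\<Sum>f\<in>F p. real N / real (Q * q p) * ?g)\<bar> \<le> (\<Sum>f\<in>F p. ?w)"
    unfolding sum_subtractf[symmetric] by (rule order_trans[OF sum_abs]) (intro sum_mono each)
  then show ?case unfolding card using insert.hyps by (simp add: field_simps)
qed

text \<open>
  The truncated alternating sum of the binomial coefficients of \<open>m + 1\<close> is \<open>(-1) ^ k\<close> times
  the binomial coefficient of \<open>m\<close> and \<open>k\<close>, hence nonnegative when the truncation point \<open>k\<close> is even.
\<close>
lemma bonferroni_upper:
  assumes "finite A"
  shows "(if A = {} then 1 else 0) \<le> (\<Sum>D | D \<subseteq> A \<and> card D \<le> 2 * r. (-1) ^ card D :: real)"
proof -
  have alt: "(\<Sum>j\<le>k. (-1) ^ j * real (Suc m choose j)) = (-1) ^ k * real (m choose k)" for m k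
    by (induction k) (simp_all add: algebra_simps)
  have "(\<Sum>D | D \<subseteq> A \<and> card D \<le> 2 * r. (-1) ^ card D :: real)
      = (\<Sum>j\<le>2*r. \<Sum>D | D \<in> {D. D \<subseteq> A \<and> card D \<le> 2 * r} \<and> card D = j. (-1) ^ card D)"
    using assms by (intro sum.group[symmetric]) auto
  also have "\<dots> = (\<Sum>j\<le>2*r. (-1) ^ j * real (card A choose j))"
  proof (intro sum.cong refl)
    fix j assume "j \<in> {..2*r}"
    then have "{D. D \<in> {D. D \<subseteq> A \<and> card D \<le> 2 * r} \<and> card D = j} = {D. D \<subseteq> A \<and> card D = j}" by auto
    then show "(\<Sum>D | D \<in> {D. D \<subseteq> A \<and> card D \<le> 2 * r} \<and> card D = j. (-1) ^ card D) = (-1) ^ j * real (card A choose j)"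
      using n_subsets[OF assms, of j] by simp
  qed
  finally have eq: "(\<Sum>D | D \<subseteq> A \<and> card D \<le> 2 * r. (-1) ^ card D :: real) = (\<Sum>j\<le>2*r. (-1) ^ j * real (card A choose j))" .
  show ?thesis
  proof (cases "A = {}")
    case True
    have "(\<Sum>j\<le>2*r. (-1) ^ j * real (0 choose j)) = (\<Sum>j\<in>{0}. (-1) ^ j * real (0 choose j))"
      by (intro sum.mono_neutral_right) auto
    then show ?thesis using eq True by simp
  next
    case False
    then obtain m where "card A = Suc m" using assms by (metis card_0_eq not0_implies_Suc)
    then show ?thesis using eq alt[where m = m and k = "2 * r"] False by simp
  qed
qed

lemma prod_one_plus_eq_sum_Pow:
  fixes g :: "'a \<Rightarrow> real"
  assumes "finite P"
  shows "(\<Prod>p\<in>P. 1 + g p) = (\<Sum>D\<in>Pow P. \<Prod>p\<in>D. g p)"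
  using prod_add[OF assms, of g "\<lambda>_. 1"] by (simp add: add.commute)

lemma prod_one_plus_le_exp_sum:
  fixes g :: "'a \<Rightarrow> real"
  assumes "\<And>p. p \<in> P \<Longrightarrow> g p \<ge> -1"
  shows "(\<Prod>p\<in>P. 1 + g p) \<le> exp (\<Sum>p\<in>P. g p)"
proof (cases "finite P")
  case True
  have "(\<Prod>p\<in>P. 1 + g p) \<le> (\<Prod>p\<in>P. exp (g p))"
  proof (rule prod_mono, safe)
    fix p assume "p \<in> P"
    then show "0 \<le> 1 + g p" using assms[of p] by linarith
  qed (rule exp_ge_add_one_self)
  then show ?thesis using True by (simp add: exp_sum)
qed auto

text \<open>
  Rankin's trick: weighting each subset by \<open>2 ^ (card D - m) \<ge> 1\<close> turns the sum into a full
  product.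
\<close>
lemma sum_subsets_large_card_le:
  fixes g :: "'a \<Rightarrow> real"
  assumes fin: "finite P" and g: "\<And>p. p \<in> P \<Longrightarrow> g p \<ge> 0"
  shows "(\<Sum>D | D \<subseteq> P \<and> card D > m. \<Prod>p\<in>D. g p) \<le> exp (2 * (\<Sum>p\<in>P. g p)) / 2 ^ m"
proof -
  have "(\<Sum>D | D \<subseteq> P \<and> card D > m. \<Prod>p\<in>D. g p) \<le> (\<Sum>D | D \<subseteq> P \<and> card D > m. (\<Prod>p\<in>D. 2 * g p) / 2 ^ m)"
  proof (rule sum_mono)
    fix D assume D: "D \<in> {D. D \<subseteq> P \<and> card D > m}"
    have nn: "0 \<le> (\<Prod>p\<in>D. g p)" using D g by (intro prod_nonneg) auto
    have "(2::real) ^ m \<le> 2 ^ card D" using D by (intro power_increasing) auto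
    from mult_right_mono[OF this nn] show "(\<Prod>p\<in>D. g p) \<le> (\<Prod>p\<in>D. 2 * g p) / 2 ^ m"
      by (simp add: prod.distrib field_simps)
  qed
  also have "\<dots> \<le> (\<Sum>D\<in>Pow P. (\<Prod>p\<in>D. 2 * g p) / 2 ^ m)"
    using fin g by (intro sum_mono2) (auto intro!: divide_nonneg_nonneg prod_nonneg)
  also have "\<dots> = (\<Prod>p\<in>P. 1 + 2 * g p) / 2 ^ m"
    by (simp add: prod_one_plus_eq_sum_Pow[OF fin] sum_divide_distrib)
  also have "\<dots> \<le> exp (\<Sum>p\<in>P. 2 * g p) / 2 ^ m"
  proof (intro divide_right_mono prod_one_plus_le_exp_sum)
    fix p assume "p \<in> P" then show "- 1 \<le> 2 * g p" using g[of p] by linarith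
  qed auto
  finally show ?thesis by (simp add: sum_distrib_left)
qed

text \<open>
  Rankin's trick in the other direction: a subset with at most \<open>m\<close> elements has
  \<open>W ^ card D \<le> W ^ m\<close>.
\<close>
lemma sum_subsets_small_card_le:
  fixes w :: "'a \<Rightarrow> real"
  assumes fin: "finite P" and w: "\<And>p. p \<in> P \<Longrightarrow> w p \<ge> 0" and W: "W \<ge> 1" "(\<Sum>p\<in>P. w p) \<le> W"
  shows "(\<Sum>D | D \<subseteq> P \<and> card D \<le> m. \<Prod>p\<in>D. w p) \<le> exp 1 * W ^ m"
proof -
  have "(\<Sum>D | D \<subseteq> P \<and> card D \<le> m. \<Prod>p\<in>D. w p) \<le> (\<Sum>D | D \<subseteq> P \<and> card D \<le> m. (\<Prod>p\<in>D. w p / W) * W ^ m)"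
  proof (rule sum_mono)
    fix D assume D: "D \<in> {D. D \<subseteq> P \<and> card D \<le> m}"
    have nn: "0 \<le> (\<Prod>p\<in>D. w p / W)" using D w W by (intro prod_nonneg) auto
    have "(\<Prod>p\<in>D. w p) = (\<Prod>p\<in>D. w p / W) * W ^ card D" using W by (simp add: prod_dividef)
    also have "\<dots> \<le> (\<Prod>p\<in>D. w p / W) * W ^ m"
      using D W by (intro mult_left_mono power_increasing nn) auto
    finally show "(\<Prod>p\<in>D. w p) \<le> (\<Prod>p\<in>D. w p / W) * W ^ m" .
  qed
  also have "\<dots> \<le> (\<Sum>D\<in>Pow P. (\<Prod>p\<in>D. w p / W) * W ^ m)"
    using fin w W by (intro sum_mono2) (auto intro!: mult_nonneg_nonneg prod_nonneg)
  also have "\<dots> = (\<Prod>p\<in>P. 1 + w p / W) * W ^ m"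
    by (simp add: prod_one_plus_eq_sum_Pow[OF fin] sum_distrib_right)
  also have "\<dots> \<le> exp (\<Sum>p\<in>P. w p / W) * W ^ m"
  proof (intro mult_right_mono prod_one_plus_le_exp_sum)
    fix p assume "p \<in> P"
    then have "0 \<le> w p / W" using w W by simp
    then show "- 1 \<le> w p / W" by linarith
  qed (use W in auto)
  also have "\<dots> \<le> exp 1 * W ^ m"
    using W by (intro mult_right_mono) (auto simp: sum_divide_distrib[symmetric])
  finally show ?thesis .
qed

text \<open>
  The Bonferroni inequality over subsets with at most \<open>2 r\<close> elements, with the main terms completed to
  the full product \<open>\<Prod> (1 - g p)\<close>.  The first error term comes from that completion, the second from
  the rounding errors in counting residue classes.
\<close>
theorem brun_pure_sieve:
  fixes q :: "'a \<Rightarrow> nat" and F :: "'a \<Rightarrow> nat set"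
  assumes fin: "finite P" and q: "\<And>p. p \<in> P \<Longrightarrow> q p > 0" and F: "\<And>p. p \<in> P \<Longrightarrow> F p \<subseteq> {..<q p}"
    and cop: "\<And>p p'. p \<in> P \<Longrightarrow> p' \<in> P \<Longrightarrow> p \<noteq> p' \<Longrightarrow> coprime (q p) (q p')"
    and W: "W \<ge> 1" "(\<Sum>p\<in>P. real (card (F p))) \<le> W"
  defines "G \<equiv> (\<Sum>p\<in>P. real (card (F p)) / real (q p))"
  shows "real (card {n. n < N \<and> (\<forall>p\<in>P. n mod q p \<notin> F p)})
      \<le> real N * (exp (- G) + exp (2 * G) / 4 ^ r) + exp 1 * W ^ (2 * r)"
proof -
  define K where "K = {D. D \<subseteq> P \<and> card D \<le> 2 * r}"
  have finK: "finite K" using fin by (simp add: K_def)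
  define g where "g p = real (card (F p)) / real (q p)" for p
  define w where "w p = real (card (F p))" for p
  have g0: "0 \<le> g p" for p by (simp add: g_def)
  have g1: "g p \<le> 1" if "p \<in> P" for p
  proof -
    have "card (F p) \<le> q p" using card_mono[OF _ F[OF that]] by simp
    then show ?thesis using q[OF that] by (simp add: g_def)
  qed
  define B where "B n = {p \<in> P. n mod q p \<in> F p}" for n
  have finB: "finite (B n)" for n using fin by (simp add: B_def)
  have "real (card {n. n < N \<and> (\<forall>p\<in>P. n mod q p \<notin> F p)}) = (\<Sum>n<N. if B n = {} then 1 else 0)"
    by (subst sum.inter_filter[symmetric]) (auto simp: B_def intro!: arg_cong[of _ _ card])
  also have "\<dots> \<le> (\<Sum>n<N. \<Sum>D | D \<subseteq> B n \<and> card D \<le> 2 * r. (-1) ^ card D)"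
    by (intro sum_mono bonferroni_upper finB)
  also have "\<dots> = (\<Sum>n<N. \<Sum>D\<in>K. if \<forall>p\<in>D. n mod q p \<in> F p then (-1) ^ card D else 0)"
  proof (rule sum.cong[OF refl])
    fix n
    have "{D. D \<subseteq> B n \<and> card D \<le> 2 * r} = {D \<in> K. \<forall>p\<in>D. n mod q p \<in> F p}"
      by (auto simp: K_def B_def)
    then show "(\<Sum>D | D \<subseteq> B n \<and> card D \<le> 2 * r. (-1) ^ card D :: real)
        = (\<Sum>D\<in>K. if \<forall>p\<in>D. n mod q p \<in> F p then (-1) ^ card D else 0)"
      using finK by (simp add: sum.inter_filter)
  qed
  also have "\<dots> = (\<Sum>D\<in>K. \<Sum>n<N. if \<forall>p\<in>D. n mod q p \<in> F p then (-1) ^ card D else 0)"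
    by (rule sum.swap)
  also have "\<dots> = (\<Sum>D\<in>K. (-1) ^ card D * real (card {n. n < N \<and> (\<forall>p\<in>D. n mod q p \<in> F p)}))"
    by (intro sum.cong refl, subst sum.inter_filter[symmetric])
       (auto simp: mult.commute intro!: arg_cong[of _ _ card])
  also have "\<dots> \<le> (\<Sum>D\<in>K. (-1) ^ card D * (real N * (\<Prod>p\<in>D. g p)) + (\<Prod>p\<in>D. w p))"
  proof (rule sum_mono)
    fix D assume "D \<in> K"
    then have D: "D \<subseteq> P" by (simp add: K_def)
    have "\<bar>real (card {n. n < N \<and> [n = 0] (mod 1) \<and> (\<forall>p\<in>D. n mod q p \<in> F p)})
           - real N / real 1 * (\<Prod>p\<in>D. real (card (F p)) / real (q p))\<bar> \<le> (\<Prod>p\<in>D. real (card (F p)))"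
      using D fin q F by (intro card_residues_in_progression cop) (auto intro: finite_subset)
    then have "\<bar>real (card {n. n < N \<and> (\<forall>p\<in>D. n mod q p \<in> F p)}) - real N * (\<Prod>p\<in>D. g p)\<bar> \<le> (\<Prod>p\<in>D. w p)"
      by (simp add: g_def w_def)
    moreover have "(-1) ^ card D = (1::real) \<or> (-1) ^ card D = (-1::real)"
      by (cases "even (card D)") auto
    ultimately show "(-1) ^ card D * real (card {n. n < N \<and> (\<forall>p\<in>D. n mod q p \<in> F p)})
        \<le> (-1) ^ card D * (real N * (\<Prod>p\<in>D. g p)) + (\<Prod>p\<in>D. w p)"
      by auto
  qed
  also have "\<dots> = real N * (\<Sum>D\<in>K. (-1) ^ card D * (\<Prod>p\<in>D. g p)) + (\<Sum>D\<in>K. \<Prod>p\<in>D. w p)"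
    by (simp add: sum.distrib sum_distrib_left mult_ac)
  also have "\<dots> \<le> real N * (exp (- G) + exp (2 * G) / 4 ^ r) + exp 1 * W ^ (2 * r)"
  proof (intro add_mono mult_left_mono)
    \<comment> \<open>Completing the truncated sum to the product over all of \<open>P\<close>.\<close>
    let ?L = "{D. D \<subseteq> P \<and> card D > 2 * r}"
    have sign: "(-1) ^ card D * (\<Prod>p\<in>D. g p) = (\<Prod>p\<in>D. - g p)" if "D \<subseteq> P" for D
      by (simp add: prod_uminus)
    have Pow: "Pow P = K \<union> ?L" by (auto simp: K_def)
    have "(\<Prod>p\<in>P. 1 + - g p) = (\<Sum>D\<in>Pow P. \<Prod>p\<in>D. - g p)"
      by (rule prod_one_plus_eq_sum_Pow[OF fin])
    also have "\<dots> = (\<Sum>D\<in>K. \<Prod>p\<in>D. - g p) + (\<Sum>D\<in>?L. \<Prod>p\<in>D. - g p)"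
      unfolding Pow by (rule sum.union_disjoint) (use fin finK in \<open>auto simp: K_def\<close>)
    finally have "(\<Sum>D\<in>K. \<Prod>p\<in>D. - g p) = (\<Prod>p\<in>P. 1 + - g p) - (\<Sum>D\<in>?L. \<Prod>p\<in>D. - g p)" by simp
    moreover have "(\<Prod>p\<in>P. 1 + - g p) \<le> exp (- G)"
      using prod_one_plus_le_exp_sum[of P "\<lambda>p. - g p"] g1 by (simp add: G_def g_def sum_negf)
    moreover have "- (\<Sum>D\<in>?L. \<Prod>p\<in>D. - g p) \<le> (\<Sum>D\<in>?L. \<Prod>p\<in>D. g p)"
    proof -
      have "- (\<Prod>p\<in>D. - g p) \<le> (\<Prod>p\<in>D. g p)" for D
      proof -
        have "0 \<le> (\<Prod>p\<in>D. g p)" by (intro prod_nonneg) (use g0 in auto)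
        then show ?thesis by (cases "even (card D)") (auto simp: prod_uminus)
      qed
      then show ?thesis unfolding sum_negf[symmetric] by (intro sum_mono)
    qed
    moreover have "(\<Sum>D\<in>?L. \<Prod>p\<in>D. g p) \<le> exp (2 * G) / 4 ^ r"
      using sum_subsets_large_card_le[OF fin, of g "2 * r"] g0 by (simp add: G_def g_def power_mult)
    moreover have "(\<Sum>D\<in>K. (-1) ^ card D * (\<Prod>p\<in>D. g p)) = (\<Sum>D\<in>K. \<Prod>p\<in>D. - g p)"
      by (intro sum.cong refl sign) (auto simp: K_def)
    ultimately show "(\<Sum>D\<in>K. (-1) ^ card D * (\<Prod>p\<in>D. g p)) \<le> exp (- G) + exp (2 * G) / 4 ^ r" by linarith
    show "(\<Sum>D\<in>K. \<Prod>p\<in>D. w p) \<le> exp 1 * W ^ (2 * r)"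
      unfolding K_def by (rule sum_subsets_small_card_le[OF fin _ W(1)]) (use W in \<open>auto simp: w_def\<close>)
  qed auto
  finally show ?thesis .
qed

section \<open>Sieving three shifts of a number\<close>
definition exactly_divides :: "nat \<Rightarrow> nat \<Rightarrow> bool" where
  "exactly_divides p n \<longleftrightarrow> p dvd n \<and> \<not> p\<^sup>2 dvd n"

text \<open>
  The restriction \<open>p < n\<close> makes this true for the primes as well, where \<open>n = p\<close> must be allowed.
\<close>
definition avoids_exact_division :: "nat set \<Rightarrow> bool" where
  "avoids_exact_division S \<longleftrightarrow>
     (\<forall>n\<in>S. \<forall>p. prime p \<and> p mod 4 = 3 \<and> p < n \<longrightarrow> \<not> exactly_divides p n)"

text \<open>
  The classes modulo \<open>p\<^sup>2\<close> of those \<open>n\<close> for which \<open>p\<close> divides some \<open>n + c\<close> exactly once.  Adding \<open>p\<^sup>2\<close>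
  keeps the subtraction of \<open>c\<close> from truncating.
\<close>
definition exact_residues :: "nat set \<Rightarrow> nat \<Rightarrow> nat set" where
  "exact_residues C p = (\<lambda>(c, u). (p * u + p\<^sup>2 - c) mod p\<^sup>2) ` (C \<times> {1..<p})"

lemma exact_residues_subset: "p > 0 \<Longrightarrow> exact_residues C p \<subseteq> {..<p\<^sup>2}"
  by (auto simp: exact_residues_def)

lemma exact_residues_shift:
  assumes "prime p" "C \<subseteq> {..<p}" "n mod p\<^sup>2 \<in> exact_residues C p"
  shows "\<exists>c\<in>C. exactly_divides p (n + c)"
proof -
  obtain c u where cu: "c \<in> C" "1 \<le> u" "u < p" "n mod p\<^sup>2 = (p * u + p\<^sup>2 - c) mod p\<^sup>2"
    using assms(3) by (auto simp: exact_residues_def)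
  have "c < p" using cu assms by auto
  then have c: "c \<le> p\<^sup>2" using self_le_power[of p 2] by (simp add: less_imp_le order_trans)
  have "[n = p * u + p\<^sup>2 - c] (mod p\<^sup>2)" using cu(4) by (simp only: cong_def)
  then have "[n + c = p * u + p\<^sup>2 - c + c] (mod p\<^sup>2)" by (rule cong_add) (rule cong_refl)
  moreover have "p * u + p\<^sup>2 - c + c = p * u + p\<^sup>2" using c by simp
  ultimately have "[n + c = p * u + p\<^sup>2] (mod p\<^sup>2)" by simp
  then have cong: "[n + c = p * u] (mod p\<^sup>2)" unfolding cong_def by (simp only: mod_add_self2)
  have "[n + c = p * u] (mod p)"
    using cong by (rule cong_dvd_modulus_nat) (simp add: power2_eq_square)
  then have "p dvd n + c" by (simp add: cong_dvd_iff)
  moreover have "\<not> p\<^sup>2 dvd n + c"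
  proof
    assume "p\<^sup>2 dvd n + c"
    then have "p\<^sup>2 dvd p * u" using cong by (simp add: cong_dvd_iff)
    then have "p dvd u" using assms(1) by (simp add: power2_eq_square)
    then show False using cu by (auto dest: dvd_imp_le)
  qed
  ultimately show ?thesis using cu by (auto simp: exactly_divides_def)
qed

text \<open>
  As \<open>C\<close> lies below \<open>p\<close>, the class modulo \<open>p\<close> determines the shift, so different shifts exclude
  disjoint sets of classes.
\<close>
lemma card_exact_residues:
  assumes "prime p" "C \<subseteq> {..<p}"
  shows "card (exact_residues C p) = card C * (p - 1)"
proof -
  have "inj_on (\<lambda>(c, u). (p * u + p\<^sup>2 - c) mod p\<^sup>2) (C \<times> {1..<p})"
  proof (rule inj_onI, clarify)
    fix c u d v
    assume c: "c \<in> C" and d: "d \<in> C" and u: "u \<in> {1..<p}" and v: "v \<in> {1..<p}"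
      and eq: "(p * u + p\<^sup>2 - c) mod p\<^sup>2 = (p * v + p\<^sup>2 - d) mod p\<^sup>2"
    have cd: "c < p" "d < p" using c d assms by auto
    then have le: "c \<le> p\<^sup>2" "d \<le> p\<^sup>2" using self_le_power[of p 2] by (simp_all add: less_imp_le order_trans)
    have "[p * u + p\<^sup>2 - c + (c + d) = p * v + p\<^sup>2 - d + (c + d)] (mod p\<^sup>2)"
      by (rule cong_add) (simp_all only: cong_def eq)
    moreover have "p * u + p\<^sup>2 - c + (c + d) = p * u + d + p\<^sup>2" "p * v + p\<^sup>2 - d + (c + d) = p * v + c + p\<^sup>2"
      using le by auto
    ultimately have "[p * u + d + p\<^sup>2 = p * v + c + p\<^sup>2] (mod p\<^sup>2)" by simp
    then have cong: "[p * u + d = p * v + c] (mod p\<^sup>2)" unfolding cong_def by (simp only: mod_add_self2)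
    then have "[p * u + d = p * v + c] (mod p)"
      by (rule cong_dvd_modulus_nat) (simp add: power2_eq_square)
    then have "d = c" using cd by (simp add: cong_def)
    then have "[p * u = p * v] (mod p * p)" using cong by (simp add: power2_eq_square cong_add_rcancel_nat)
    then have "(p * u) mod (p * p) = (p * v) mod (p * p)" by (simp add: cong_def)
    moreover have "p * u < p * p" "p * v < p * p" using u v by auto
    ultimately have "u = v" using assms(1) by (simp add: prime_gt_0_nat)
    then show "c = d \<and> u = v" using \<open>d = c\<close> by simp
  qed
  then show ?thesis by (simp add: exact_residues_def card_image card_cartesian_product)
qed

lemma card_tuples_le_sieve:
  assumes S: "avoids_exact_division S" and fin: "finite P" and P: "\<And>p. p \<in> P \<Longrightarrow> prime p \<and> p mod 4 = 3 \<and> p \<le> Z"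
    and C: "finite C" "\<And>p. p \<in> P \<Longrightarrow> C \<subseteq> {..<p}" and Z: "Z \<ge> 1" and C1: "C \<noteq> {}"
  defines "G \<equiv> (\<Sum>p\<in>P. real (card C) * (real p - 1) / (real p)\<^sup>2)"
  shows "real (card {n. n < N \<and> Z < n \<and> (\<forall>c\<in>C. n + c \<in> S)}) \<le>
    real N * (exp (- G) + exp (2 * G) / 4 ^ r) + exp 1 * (real (card C) * (real Z)\<^sup>2) ^ (2 * r)"
proof -
  have sub: "{n. n < N \<and> Z < n \<and> (\<forall>c\<in>C. n + c \<in> S)} \<subseteq>
      {n. n < N \<and> (\<forall>p\<in>P. n mod p\<^sup>2 \<notin> exact_residues C p)}"
  proof safe
    fix n p assume n: "n < N" "Z < n" "\<forall>c\<in>C. n + c \<in> S" "p \<in> P" "n mod p\<^sup>2 \<in> exact_residues C p"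
    then obtain c where c: "c \<in> C" "exactly_divides p (n + c)"
      using exact_residues_shift[of p C n] P C by auto
    moreover have "p < n + c" using P[of p] n by auto
    ultimately show False using S n P[of p] by (auto simp: avoids_exact_division_def)
  qed
  have card_real: "real (card (exact_residues C p)) = real (card C) * (real p - 1)" if "p \<in> P" for p
    using card_exact_residues[of p C] P[OF that] C(2)[OF that] prime_ge_1_nat[of p] by (simp add: of_nat_diff)
  have "(\<Sum>p\<in>P. real (card (exact_residues C p))) \<le> (\<Sum>p\<in>P. real (card C) * real Z)"
  proof (rule sum_mono)
    fix p assume p: "p \<in> P"
    then show "real (card (exact_residues C p)) \<le> real (card C) * real Z"
      unfolding card_real[OF p] using P[OF p] by (intro mult_left_mono) auto
  qed
  also have "\<dots> = real (card P) * (real (card C) * real Z)" by simp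
  also have "real (card P) \<le> real Z"
  proof -
    have "P \<subseteq> {1..Z}" using P prime_ge_1_nat by auto
    then show ?thesis using card_mono[of "{1..Z}" P] by simp
  qed
  finally have W: "(\<Sum>p\<in>P. real (card (exact_residues C p))) \<le> real (card C) * (real Z)\<^sup>2"
    by (simp add: mult_right_mono power2_eq_square mult_ac)
  have G: "G = (\<Sum>p\<in>P. real (card (exact_residues C p)) / real (p\<^sup>2))"
    unfolding G_def by (intro sum.cong refl) (simp add: card_real)
  have W1: "1 \<le> real (card C) * (real Z)\<^sup>2"
  proof -
    have "1 \<le> card C * Z\<^sup>2" using C C1 Z by (simp add: Suc_le_eq card_gt_0_iff)
    then show ?thesis by (metis of_nat_1 of_nat_le_iff of_nat_mult of_nat_power)
  qed
  have "real (card {n. n < N \<and> Z < n \<and> (\<forall>c\<in>C. n + c \<in> S)}) \<le>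
     real (card {n. n < N \<and> (\<forall>p\<in>P. n mod p\<^sup>2 \<notin> exact_residues C p)})"
    using sub by (intro of_nat_mono card_mono) auto
  also have "\<dots> \<le> real N * (exp (- G) + exp (2 * G) / 4 ^ r) + exp 1 * (real (card C) * (real Z)\<^sup>2) ^ (2 * r)"
    unfolding G
  proof (rule brun_pure_sieve[OF fin _ _ _ W1 W])
    fix p assume "p \<in> P"
    then have "p > 0" using P prime_gt_0_nat by auto
    then show "0 < p\<^sup>2" "exact_residues C p \<subseteq> {..<p\<^sup>2}" using exact_residues_subset by auto
    fix p' assume "p' \<in> P" "p \<noteq> p'"
    then show "coprime (p\<^sup>2) (p'\<^sup>2)" using P \<open>p \<in> P\<close> by (simp add: primes_coprime)
  qed
  finally show ?thesis .
qed

text \<open>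
  The sieve needs its sum \<open>G\<close> to be neither too small nor too large; discarding some of the primes
  achieves the latter.
\<close>
lemma subset_sum_in_unit_window:
  fixes g :: "'a \<Rightarrow> real"
  assumes "finite P" "\<And>p. p \<in> P \<Longrightarrow> 0 \<le> g p \<and> g p \<le> 1" "0 \<le> T" "T \<le> sum g P"
  shows "\<exists>P'\<subseteq>P. T \<le> sum g P' \<and> sum g P' \<le> T + 1"
  using assms
proof (induction P)
  case (insert p P)
  show ?case
  proof (cases "T \<le> sum g P")
    case True
    then obtain P' where "P' \<subseteq> P" "T \<le> sum g P'" "sum g P' \<le> T + 1"
      using insert by auto
    then show ?thesis by blast
  next
    case False
    moreover have "g p \<le> 1" using insert.prems(1)[of p] by simp
    ultimately have "sum g (insert p P) \<le> T + 1" using insert.hyps by simp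
    then show ?thesis using insert.prems by blast
  qed
qed auto

lemma harm_le_ln: "n \<ge> 1 \<Longrightarrow> harm n \<le> 1 + ln (real n)"
  using euler_mascheroni_sequence_decreasing[of 1 n] by (simp add: harm_def)

text \<open>
  Here \<open>y\<close> is the sieving range: its factor 60 leaves the rounding error of the sieve, a power
  \<open>y ^ (24 L)\<close>, equal to \<open>x powr (2/5)\<close>.  The target \<open>5/4 L\<close> for the sieve sum lies below the available
  \<open>3 * 23/50 * L\<close> and yields the saving \<open>(ln x) powr (-5/4)\<close>; the \<open>L\<^sup>2\<close> pairs of shifts and other
  powers of \<open>L\<close> are absorbed on the way from 5/4 to 6/5.
\<close>
lemma close_triples_parameters:
  defines "L \<equiv> \<lambda>x::real. ln (ln x)"
  defines "y \<equiv> \<lambda>x. exp (ln x / (60 * L x))"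
  shows "eventually (\<lambda>x. x \<ge> 1 \<and> ln x > 0 \<and> L x \<ge> 16 \<and> y x \<ge> 8 \<and> ln x / (60 * L x) > ln 2 + 1 \<and>
     3 * ((23/50) * ln (ln x / (60 * L x) - ln 2) - (1 + ln (L x))) - 3 \<ge> 5/4 * L x \<and>
     y x + 1 + (L x)\<^sup>2 * ((x + 1) * (2 * exp (- (5/4 * L x))) + exp 1 * exp (2/5 * ln x))
       \<le> x / ln x powr (6/5)) at_top"
  unfolding L_def y_def by (intro eventually_conj; real_asymp)

lemma card_close_triples_le:
  assumes S: "avoids_exact_division S" and fin: "finite P"
    and P: "\<And>p. p \<in> P \<Longrightarrow> prime p \<and> p mod 4 = 3 \<and> H < p \<and> p \<le> Z" and Z: "Z \<ge> 1"
  defines "G \<equiv> (\<Sum>p\<in>P. 3 * (real p - 1) / (real p)\<^sup>2)"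
  shows "real (card {n. n < N \<and> (\<exists>a b. 0 < a \<and> a < b \<and> b \<le> H \<and> n \<in> S \<and> n + a \<in> S \<and> n + b \<in> S)}) \<le>
    real Z + 1 + (real H)\<^sup>2 * (real N * (exp (- G) + exp (2 * G) / 4 ^ r) + exp 1 * (3 * (real Z)\<^sup>2) ^ (2 * r))"
proof -
  define I where "I = {(a, b). a \<in> {1..H} \<and> b \<in> {1..H} \<and> a < b}"
  define U where "U = (\<lambda>(a, b). {n. n < N \<and> Z < n \<and> (\<forall>c\<in>{0, a, b}. n + c \<in> S)})"
  let ?B = "real N * (exp (- G) + exp (2 * G) / 4 ^ r) + exp 1 * (3 * (real Z)\<^sup>2) ^ (2 * r)"
  have I: "finite I" "card I \<le> H\<^sup>2"
  proof -
    have sub: "I \<subseteq> {1..H} \<times> {1..H}" by (auto simp: I_def)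
    show "finite I" by (rule finite_subset[OF sub]) simp
    show "card I \<le> H\<^sup>2"
      using card_mono[OF _ sub] by (simp add: card_cartesian_product power2_eq_square)
  qed
  have "real (card (U i)) \<le> ?B" if "i \<in> I" for i
  proof -
    obtain a b where ab: "i = (a, b)" "0 < a" "a < b" "b \<le> H" using \<open>i \<in> I\<close> by (auto simp: I_def)
    have card: "card {0, a, b} = 3" using ab by simp
    have "{0, a, b} \<subseteq> {..<p}" if "p \<in> P" for p using P[OF that] ab by auto
    with card_tuples_le_sieve[OF S fin, of Z "{0, a, b}" N r] P Z
    show ?thesis unfolding card ab(1) U_def G_def by simp
  qed
  then have "(\<Sum>i\<in>I. real (card (U i))) \<le> real (card I) * ?B"
    by (rule sum_bounded_above)
  also have "\<dots> \<le> (real H)\<^sup>2 * ?B"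
  proof (rule mult_right_mono)
    show "real (card I) \<le> (real H)\<^sup>2" using I(2) by (metis of_nat_le_iff of_nat_power)
  qed (auto intro!: add_nonneg_nonneg)
  finally have sum: "(\<Sum>i\<in>I. real (card (U i))) \<le> (real H)\<^sup>2 * ?B" .
  have finU: "finite (U i)" for i by (auto simp: U_def split: prod.split)
  have "{n. n < N \<and> (\<exists>a b. 0 < a \<and> a < b \<and> b \<le> H \<and> n \<in> S \<and> n + a \<in> S \<and> n + b \<in> S)}
      \<subseteq> {..Z} \<union> (\<Union>i\<in>I. U i)"
    by (fastforce simp: I_def U_def)
  then have "card {n. n < N \<and> (\<exists>a b. 0 < a \<and> a < b \<and> b \<le> H \<and> n \<in> S \<and> n + a \<in> S \<and> n + b \<in> S)}
      \<le> card ({..Z} \<union> (\<Union>i\<in>I. U i))"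
    using I finU by (intro card_mono) auto
  also have "\<dots> \<le> card {..Z} + card (\<Union>i\<in>I. U i)" by (rule card_Un_le)
  also have "\<dots> \<le> (Z + 1) + (\<Sum>i\<in>I. card (U i))"
    using card_UN_le[OF I(1), of U] by simp
  finally have "real (card {n. n < N \<and> (\<exists>a b. 0 < a \<and> a < b \<and> b \<le> H \<and> n \<in> S \<and> n + a \<in> S \<and> n + b \<in> S)})
      \<le> real (Z + 1 + (\<Sum>i\<in>I. card (U i)))" by (rule of_nat_mono)
  then show ?thesis using sum by simp
qed

text \<open>
  Only primes above \<open>ln (ln x)\<close> are used, since smaller ones could divide differences of shifts.  They
  cost the sum of reciprocals at most \<open>1 + ln (ln (ln x))\<close>.  The exponent 6/5 only has to exceed 1, the
  exponent in the lower bound for \<open>S(x)\<close>.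
\<close>
theorem few_close_triples:
  assumes S: "avoids_exact_division S"
  shows "eventually (\<lambda>x::real. real (card {n \<in> S. real n \<le> x \<and>
      (\<exists>a b. 0 < a \<and> a < b \<and> real b \<le> ln (ln x) \<and> n + a \<in> S \<and> n + b \<in> S)}) \<le> x / ln x powr (6/5)) at_top"
proof -
  define L where "L x = ln (ln x)" for x :: real
  define y where "y x = exp (ln x / (60 * L x))" for x :: real
  have "filterlim (\<lambda>x::real. nat \<lfloor>y x\<rfloor>) sequentially at_top"
  proof -
    have "filterlim y at_top at_top" unfolding y_def L_def by real_asymp
    from filterlim_compose[OF filterlim_nat_sequentially filterlim_compose[OF filterlim_floor_sequentially this]]
    show ?thesis .
  qed
  from eventually_compose_filterlim[OF mertens_primes_3_mod_4 this]
    close_triples_parameters[folded L_def, folded y_def]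
  show ?thesis
  proof eventually_elim
    case (elim x)
    define Z where "Z = nat \<lfloor>y x\<rfloor>"
    define H where "H = nat \<lfloor>L x\<rfloor>"
    define Q where "Q h = {p. prime p \<and> p mod 4 = 3 \<and> h < p \<and> p \<le> Z}" for h
    define g where "g p = 3 * (real p - 1) / (real p)\<^sup>2" for p :: nat
    define T where "T = 5/4 * L x"
    have x: "x \<ge> 1" "ln x > 0" and L: "L x \<ge> 16" and y8: "y x \<ge> 8" using elim by auto
    have Zy: "real Z \<le> y x" "y x < real Z + 1" unfolding Z_def using y8 by linarith+
    have H: "1 \<le> H" "real H \<le> L x" unfolding H_def using L by linarith+
    have finQ: "finite (Q h)" for h by (rule finite_subset[of _ "{..Z}"]) (auto simp: Q_def)
    have "ln (ln x / (60 * L x) - ln 2) \<le> ln (ln (real Z))"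
    proof -
      have "ln (y x / 2) \<le> ln (real Z)" using Zy y8 by (intro ln_mono) auto
      moreover have "ln (y x / 2) = ln x / (60 * L x) - ln 2" by (simp add: ln_div y_def)
      moreover have "ln x / (60 * L x) - ln 2 > 0" using elim by linarith
      ultimately show ?thesis by (intro ln_mono) auto
    qed
    moreover have "(23/50) * ln (ln (real Z)) \<le> (\<Sum>p\<in>Q 0. 1 / real p)"
    proof -
      have "Q 0 = {p. prime p \<and> p mod 4 = 3 \<and> p \<le> Z}" by (auto simp: Q_def prime_gt_0_nat)
      then show ?thesis using elim by (simp add: Z_def)
    qed
    moreover have "(\<Sum>p\<in>Q 0. 1 / real p) \<le> (\<Sum>p\<in>Q H. 1 / real p) + (1 + ln (L x))"
    proof -
      have "(\<Sum>p\<in>Q 0. 1 / real p) \<le> (\<Sum>p\<in>Q H \<union> {1..H}. 1 / real p)"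
        using finQ by (intro sum_mono2) (auto simp: Q_def)
      also have "\<dots> = (\<Sum>p\<in>Q H. 1 / real p) + (\<Sum>p=1..H. 1 / real p)"
        using finQ by (intro sum.union_disjoint) (auto simp: Q_def)
      also have "(\<Sum>p=1..H. 1 / real p) = harm H" by (simp add: harm_def inverse_eq_divide)
      also have "harm H \<le> 1 + ln (real H)" using H by (intro harm_le_ln) auto
      also have "ln (real H) \<le> ln (L x)" using H by (intro ln_mono) auto
      finally show ?thesis by simp
    qed
    ultimately have Q_sum: "(23/50) * ln (ln x / (60 * L x) - ln 2) - (1 + ln (L x)) \<le> (\<Sum>p\<in>Q H. 1 / real p)"
      by linarith
    have Q2: "p \<ge> 2" if "p \<in> Q H" for p using that prime_ge_2_nat by (auto simp: Q_def)
    have g_eq: "g p = 3 * (1 / real p) - 3 * (1 / (real p)\<^sup>2)" if "p \<in> Q H" for p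
      using Q2[OF that] by (simp add: g_def field_simps power2_eq_square)
    have "T \<le> sum g (Q H)"
    proof -
      define A where "A = (\<Sum>p\<in>Q H. 1 / real p)"
      define B where "B = (\<Sum>p\<in>Q H. 1 / (real p)\<^sup>2)"
      define E where "E = (23/50) * ln (ln x / (60 * L x) - ln 2) - (1 + ln (L x))"
      have "sum g (Q H) = 3 * A - 3 * B"
        unfolding A_def B_def using g_eq by (simp add: sum_subtractf sum_distrib_left)
      moreover have "B \<le> 1"
        unfolding B_def by (intro sum_inverse_squares_le_1 finQ Q2)
      moreover have "3 * E - 3 \<ge> T" using elim by (simp add: T_def E_def)
      moreover have "E \<le> A" using Q_sum by (simp add: A_def E_def)
      ultimately show ?thesis by linarith
    qed
    moreover have "0 \<le> g p \<and> g p \<le> 1" if "p \<in> Q H" for p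
    proof -
      \<comment> \<open>The discriminant of \<open>p\<^sup>2 - 3 p + 3\<close> is negative.\<close>
      have "0 \<le> (real p - 3 / 2)\<^sup>2 + 3/4" by simp
      then have "3 * (real p - 1) \<le> (real p)\<^sup>2" by (simp add: power2_eq_square algebra_simps)
      then show ?thesis using Q2[OF that] by (simp add: g_def divide_le_eq)
    qed
    ultimately obtain P where P: "P \<subseteq> Q H" "T \<le> sum g P" "sum g P \<le> T + 1"
      using subset_sum_in_unit_window[of "Q H" g T] finQ L by (auto simp: T_def)
    define G where "G = sum g P"
    \<comment> \<open>Long enough that the truncation error \<open>exp (2 G) / 4 ^ r\<close> is at most \<open>exp (- G)\<close>, as \<open>4 > exp 1\<close>.\<close>
    define r where "r = nat \<lceil>3 * (T + 1)\<rceil>"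
    have r: "3 * G \<le> real r" "real (2 * r) \<le> 8 * L x"
    proof -
      have "3 * G \<le> 3 * (T + 1)" using P(3) by (simp add: G_def)
      then show "3 * G \<le> real r" unfolding r_def by linarith
      have "0 \<le> 3 * (T + 1)" using L by (simp add: T_def)
      then have "real r \<le> 3 * (T + 1) + 1" unfolding r_def by linarith
      then show "real (2 * r) \<le> 8 * L x" using L by (simp add: T_def)
    qed
    define N where "N = nat \<lfloor>x\<rfloor> + 1"
    have N: "real N \<le> x + 1" unfolding N_def using x by simp
    have Z8: "real Z \<ge> 3" "Z \<ge> 1" using Zy y8 by linarith+
    have "exp (2 * G) / 4 ^ r \<le> exp (- G)"
    proof -
      have "exp (3 * G) \<le> exp (real r)" using r by simp
      also have "\<dots> = exp 1 ^ r" by (simp add: exp_of_nat_mult[symmetric])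
      also have "\<dots> \<le> 4 ^ r" using exp_le by (intro power_mono) auto
      finally have "exp (3 * G) * exp (- G) \<le> 4 ^ r * exp (- G)" by (rule mult_right_mono) simp
      then show ?thesis by (simp add: divide_le_eq mult.commute flip: exp_add)
    qed
    moreover have "exp (- G) \<le> exp (- T)" using P(2) by (simp add: G_def)
    ultimately have e1: "exp (- G) + exp (2 * G) / 4 ^ r \<le> 2 * exp (- T)" by linarith
    have e2: "(3 * (real Z)\<^sup>2) ^ (2 * r) \<le> exp (2/5 * ln x)"
    proof -
      have "3 * (real Z)\<^sup>2 \<le> real Z * (real Z)\<^sup>2" using Z8 by (intro mult_right_mono) auto
      also have "\<dots> = real Z ^ 3" by (simp add: power2_eq_square power3_eq_cube)
      also have "\<dots> \<le> y x ^ 3" using Zy by (intro power_mono) auto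
      finally have "(3 * (real Z)\<^sup>2) ^ (2 * r) \<le> (y x ^ 3) ^ (2 * r)" by (intro power_mono) auto
      also have "\<dots> = exp (real (2 * r) * (3 * (ln x / (60 * L x))))"
        unfolding y_def exp_of_nat_mult[symmetric] by simp
      also have "\<dots> \<le> exp (8 * L x * (3 * (ln x / (60 * L x))))"
        using r(2) x L by (subst exp_le_cancel_iff, intro mult_right_mono) auto
      also have "8 * L x * (3 * (ln x / (60 * L x))) = 2/5 * ln x" using L by simp
      finally show ?thesis .
    qed
    have "real (card {n \<in> S. real n \<le> x \<and> (\<exists>a b. 0 < a \<and> a < b \<and> real b \<le> ln (ln x) \<and> n + a \<in> S \<and> n + b \<in> S)})
       \<le> real (card {n. n < N \<and> (\<exists>a b. 0 < a \<and> a < b \<and> b \<le> H \<and> n \<in> S \<and> n + a \<in> S \<and> n + b \<in> S)})"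
    proof (intro of_nat_mono card_mono subsetI)
      fix n assume "n \<in> {n \<in> S. real n \<le> x \<and> (\<exists>a b. 0 < a \<and> a < b \<and> real b \<le> ln (ln x) \<and> n + a \<in> S \<and> n + b \<in> S)}"
      then obtain a b where n: "n \<in> S" "real n \<le> x" "0 < a" "a < b" "real b \<le> L x" "n + a \<in> S" "n + b \<in> S"
        by (auto simp: L_def)
      have "n < N" "b \<le> H" unfolding N_def H_def using n by linarith+
      then show "n \<in> {n. n < N \<and> (\<exists>a b. 0 < a \<and> a < b \<and> b \<le> H \<and> n \<in> S \<and> n + a \<in> S \<and> n + b \<in> S)}"
        using n by blast
    qed simp
    also have "\<dots> \<le> real Z + 1 + (real H)\<^sup>2 * (real N * (exp (- G) + exp (2 * G) / 4 ^ r) + exp 1 * (3 * (real Z)\<^sup>2) ^ (2 * r))"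
      unfolding G_def g_def
    proof (rule card_close_triples_le[OF S _ _ Z8(2)])
      show "finite P" using P(1) finQ finite_subset by blast
    qed (use P(1) in \<open>auto simp: Q_def\<close>)
    also have "\<dots> \<le> y x + 1 + (L x)\<^sup>2 * ((x + 1) * (2 * exp (- T)) + exp 1 * exp (2/5 * ln x))"
      by (intro add_mono mult_mono power_mono e1 e2 N H Zy)
         (use x in \<open>auto intro!: add_nonneg_nonneg mult_nonneg_nonneg\<close>)
    also have "\<dots> \<le> x / ln x powr (6/5)" using elim by (simp add: T_def)
    finally show ?case .
  qed
qed

section \<open>Primes and sums of two squares under the sieve\<close>
lemma primes_avoid_exact_division: "avoids_exact_division primes"
proof -
  have "\<not> p dvd n" if "prime n" "prime p" "p < n" for p n :: nat
    using that primes_dvd_imp_eq by blast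
  then show ?thesis
    by (auto simp: avoids_exact_division_def exactly_divides_def primes_def)
qed

text \<open>
  Otherwise \<open>a\<^sup>2 = - b\<^sup>2\<close> modulo \<open>p\<close> with both sides invertible; raising this to the odd power \<open>(p - 1) / 2\<close>
  gives \<open>1 = - 1\<close> by Fermat's little theorem.
\<close>
lemma dvd_sum_two_squares_3_mod_4:
  fixes p a b :: nat
  assumes p: "prime p" "p mod 4 = 3" and dvd: "p dvd a\<^sup>2 + b\<^sup>2"
  shows "p dvd a"
proof (rule ccontr)
  assume a: "\<not> p dvd a"
  have b: "\<not> p dvd b"
  proof
    assume "p dvd b"
    then have "p dvd b\<^sup>2" by (simp add: power2_eq_square)
    with dvd have "p dvd a\<^sup>2" by (metis dvd_add_left_iff)
    with p(1) a show False using prime_dvd_power by blast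
  qed
  define k where "k = p div 4"
  have k: "p = 4 * k + 3" using p(2) div_mult_mod_eq[of p 4] by (simp add: k_def)
  then have pk: "p - 1 = 2 * (2 * k + 1)" by simp
  define x where "x = int a ^ 2"
  define y where "y = int b ^ 2"
  have "int p dvd x + y"
  proof -
    have "int p dvd int (a\<^sup>2 + b\<^sup>2)" using dvd by (simp only: of_nat_dvd_iff)
    then show ?thesis by (simp add: x_def y_def)
  qed
  then have "[x = - y] (mod int p)" by (simp add: cong_iff_dvd_diff)
  then have "[x ^ (2 * k + 1) = (- y) ^ (2 * k + 1)] (mod int p)" by (rule cong_pow)
  moreover have "(- y) ^ (2 * k + 1) = - (y ^ (2 * k + 1))" by simp
  moreover have "[x ^ (2 * k + 1) = 1] (mod int p)" "[y ^ (2 * k + 1) = 1] (mod int p)"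
  proof -
    have "[int (c ^ (p - 1)) = int 1] (mod int p)" if "\<not> p dvd c" for c
      using fermat_theorem[OF p(1) that] by (simp only: cong_int_iff)
    from this[OF a] this[OF b]
    show "[x ^ (2 * k + 1) = 1] (mod int p)" "[y ^ (2 * k + 1) = 1] (mod int p)"
      unfolding pk x_def y_def power_mult[symmetric] by simp_all
  qed
  ultimately have "[1 = - (y ^ (2 * k + 1))] (mod int p)" "[- (y ^ (2 * k + 1)) = - 1] (mod int p)"
    by (metis cong_sym cong_trans, simp add: cong_minus_minus_iff)
  then have "[1 = - 1] (mod int p)" by (rule cong_trans)
  then have "int p dvd 2" by (simp add: cong_iff_dvd_diff)
  then have "p dvd 2" by (metis of_nat_dvd_iff of_nat_numeral)
  then show False using k by (auto dest: dvd_imp_le)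
qed

lemma sums_of_two_squares_avoid_exact_division: "avoids_exact_division sums_of_two_squares"
  unfolding avoids_exact_division_def exactly_divides_def
proof safe
  fix n p :: nat
  assume n: "n \<in> sums_of_two_squares" and p: "prime p" "p mod 4 = 3" "p dvd n" "\<not> p\<^sup>2 dvd n"
  obtain u v :: int where uv: "int n = u\<^sup>2 + v\<^sup>2" using n by (auto simp: sums_of_two_squares_def)
  define a where "a = nat \<bar>u\<bar>"
  define b where "b = nat \<bar>v\<bar>"
  have "int n = int (a\<^sup>2 + b\<^sup>2)" by (simp add: uv a_def b_def)
  then have n_eq: "n = a\<^sup>2 + b\<^sup>2" by (simp only: of_nat_eq_iff)
  have "p dvd a" "p dvd b"
    using dvd_sum_two_squares_3_mod_4[of p a b] dvd_sum_two_squares_3_mod_4[of p b a] p n_eq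
    by (auto simp: add.commute)
  then have "p\<^sup>2 dvd a\<^sup>2 + b\<^sup>2" by (simp add: dvd_power_same)
  with p n_eq show False by simp
qed

section \<open>A lower bound for the number of primes\<close>

text \<open>
  The numbers \<open>1 / ((m + 1) * (m choose k))\<close> form Leibniz's harmonic triangle, in which each entry is the
  difference of two entries of the preceding column.  So if \<open>R\<close> times every entry \<open>1 / j\<close> of the first
  column is an integer, then \<open>R\<close> times every entry is.
\<close>
lemma leibniz_triangle_dvd:
  fixes R m k n :: nat
  assumes R: "\<And>j. 1 \<le> j \<Longrightarrow> j \<le> n \<Longrightarrow> j dvd R" and "m < n" "k \<le> m"
  shows "(m + 1) * (m choose k) dvd R"
  using assms(2,3)
proof (induction k arbitrary: m)
  case 0
  then show ?case using R[of "m + 1"] by simp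
next
  case (Suc k)
  define u where "u = (m + 1) * (m choose k)"
  define v where "v = m * ((m - 1) choose k)"
  define w where "w = (m + 1) * (m choose Suc k)"
  have m: "m \<ge> 1" "k \<le> m - 1" using Suc.prems by auto
  have "u dvd R" using Suc by (simp add: u_def)
  then obtain s where s: "R = u * s" by auto
  have "v dvd R" using Suc.IH[of "m - 1"] Suc.prems m by (simp add: v_def)
  then obtain t where t: "R = v * t" by auto
  have vu: "(m + 1) * v = (m - k) * u"
    unfolding u_def v_def binomial_absorb_comp[symmetric] by (simp add: algebra_simps)
  have wv: "(k + 1) * w = (m + 1) * v"
  proof -
    have "(k + 1) * w = (m + 1) * (Suc k * (m choose Suc k))"
      unfolding w_def by (simp only: mult_ac Suc_eq_plus1)
    then show ?thesis by (simp only: binomial_absorption v_def)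
  qed
  have v0: "v > 0" using m by (simp add: v_def)
  have "v * ((m + 1) * s) = v * ((m - k) * t)"
    using vu s t by (metis mult.assoc mult.left_commute)
  then have st: "(m + 1) * s = (m - k) * t" using v0 by simp
  have ts: "(m + 1) * (t - s) = (k + 1) * t"
  proof -
    have "(m + 1) * (t - s) = (m + 1) * t - (m - k) * t" by (simp only: diff_mult_distrib2 st)
    also have "\<dots> = (m + 1 - (m - k)) * t" by (simp only: diff_mult_distrib)
    also have "m + 1 - (m - k) = k + 1" using Suc.prems by simp
    finally show ?thesis .
  qed
  have "(k + 1) * (w * (t - s)) = v * ((m + 1) * (t - s))" using wv by (metis mult.assoc mult.commute)
  also have "\<dots> = (k + 1) * R" unfolding ts by (simp only: t mult_ac)
  finally have "w * (t - s) = R" by (metis mult_cancel1 add_is_0 one_neq_zero)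
  then show ?case unfolding w_def by auto
qed

text \<open>
  Take for \<open>R\<close> the least common multiple of \<open>1, \<dots>, n\<close>, written as a product of prime powers, each at
  most \<open>n\<close>.  It bounds every entry of row \<open>n\<close> of the triangle, and the entries \<open>n * (n - 1 choose k)\<close> add up
  to \<open>n * 2 ^ (n - 1)\<close>.
\<close>
lemma two_power_le_power_prime_count:
  assumes n: "n \<ge> 1"
  shows "2 ^ (n - 1) \<le> n ^ card {p. prime p \<and> p \<le> n}"
proof -
  define P where "P = {p. prime p \<and> p \<le> n}"
  define e where "e p = Max (multiplicity p ` {1..n})" for p :: nat
  define R where "R = (\<Prod>p\<in>P. p ^ e p)"
  have finP: "finite P" by (simp add: P_def)
  have "R \<le> (\<Prod>p\<in>P. n)"
    unfolding R_def
  proof (rule prod_mono, safe)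
    fix p assume "p \<in> P"
    have "e p \<in> multiplicity p ` {1..n}" unfolding e_def using n by (intro Max_in) auto
    then obtain j where j: "j \<in> {1..n}" "e p = multiplicity p j" by auto
    then have "p ^ e p dvd j" by (simp add: multiplicity_dvd)
    then have "p ^ e p \<le> j" using j by (intro dvd_imp_le) auto
    then show "p ^ e p \<le> n" using j by simp
  qed
  then have R_le: "R \<le> n ^ card P" by simp
  have R_pos: "R > 0" unfolding R_def by (intro prod_pos) (auto simp: P_def prime_gt_0_nat)
  have dvd: "j dvd R" if j: "1 \<le> j" "j \<le> n" for j
  proof (rule multiplicity_le_imp_dvd)
    fix p :: nat assume p: "prime p"
    show "multiplicity p j \<le> multiplicity p R"
    proof (cases "p \<in> P")
      case True
      have "multiplicity p R = e p"
        unfolding R_def using True finP by (subst multiplicity_prod_prime_powers) (auto simp: P_def p)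
      moreover have "multiplicity p j \<le> e p" unfolding e_def using j by (intro Max_ge) auto
      ultimately show ?thesis by simp
    next
      case False
      then have "p > n" using p by (auto simp: P_def)
      then have "\<not> p dvd j" using j by (auto dest: dvd_imp_le)
      then show ?thesis by (simp add: not_dvd_imp_multiplicity_0)
    qed
  qed (use j in auto)
  have "n * 2 ^ (n - 1) = (\<Sum>k\<le>n - 1. n * ((n - 1) choose k))"
    by (simp add: choose_row_sum sum_distrib_left[symmetric])
  also have "\<dots> \<le> (\<Sum>k\<le>n - 1. R)"
  proof (rule sum_mono)
    fix k assume "k \<in> {..n - 1}"
    then have "(n - 1 + 1) * ((n - 1) choose k) dvd R"
      using n by (intro leibniz_triangle_dvd[where n = n] dvd) auto
    then show "n * ((n - 1) choose k) \<le> R" using R_pos n by (intro dvd_imp_le) auto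
  qed
  also have "\<dots> = n * R" using n by simp
  finally have "2 ^ (n - 1) \<le> R" using n by simp
  then show ?thesis using R_le by (simp add: P_def)
qed

lemma primes_lower_bound:
  "\<exists>c>0. eventually (\<lambda>x. c * x / ln x \<le> counting primes x) at_top"
proof (intro exI conjI)
  show "eventually (\<lambda>x. (1/4) * x / ln x \<le> counting primes x) at_top"
    using eventually_ge_at_top[of 4]
  proof eventually_elim
    case (elim x)
    define n where "n = nat \<lfloor>x\<rfloor>"
    have n: "n \<ge> 4" "real n \<le> x" "x < real n + 1" unfolding n_def using elim by linarith+
    define \<pi> where "\<pi> = card {p. prime p \<and> p \<le> n}"
    have "{s \<in> primes. 1 \<le> real s \<and> real s \<le> x} = {p. prime p \<and> p \<le> n}"
    proof -
      have "real s \<le> x \<longleftrightarrow> s \<le> n" for s unfolding n_def using elim by linarith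
      then show ?thesis using prime_ge_1_nat by (auto simp: primes_def)
    qed
    then have count: "counting primes x = real \<pi>" by (simp add: counting_def \<pi>_def)
    have "2 ^ (n - 1) \<le> n ^ \<pi>" unfolding \<pi>_def by (rule two_power_le_power_prime_count) (use n in simp)
    then have "real (2 ^ (n - 1)) \<le> real (n ^ \<pi>)" by (rule of_nat_mono)
    then have "ln (2 ^ (n - 1)) \<le> ln (real n ^ \<pi>)" using n by (subst ln_le_cancel_iff) auto
    then have "real (n - 1) * ln 2 \<le> real \<pi> * ln (real n)" using n by (simp add: ln_realpow)
    also have "\<dots> \<le> real \<pi> * ln x" using n by (intro mult_left_mono ln_mono) auto
    finally have "real (n - 1) * ln 2 \<le> real \<pi> * ln x" .
    moreover have "(x - 2) * (2/3) \<le> real (n - 1) * ln 2"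
      using n ln2_ge_two_thirds by (intro mult_mono) auto
    moreover have "x / 4 \<le> (x - 2) * (2/3)" using elim by simp
    ultimately have "x / 4 \<le> real \<pi> * ln x" by (meson order_trans)
    moreover have "ln x > 0" using elim by simp
    ultimately show ?case unfolding count by (simp add: divide_le_eq)
  qed
qed simp

section \<open>A lower bound for the number of sums of two squares\<close>
definition product_solutions :: "nat \<Rightarrow> (nat \<times> nat \<times> nat \<times> nat) set" where
  "product_solutions N = {(u, v, w, t). u \<in> {1..N} \<and> v \<in> {1..N} \<and> w \<in> {1..N} \<and> t \<in> {1..N} \<and> u * v = w * t}"

lemma finite_product_solutions: "finite (product_solutions N)"
proof (rule finite_subset)
  show "product_solutions N \<subseteq> {1..N} \<times> {1..N} \<times> {1..N} \<times> {1..N}"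
    by (auto simp: product_solutions_def)
qed auto

text \<open>
  Dividing \<open>u\<close> and \<open>w\<close> by their greatest common divisor \<open>g\<close> writes a solution as
  \<open>(g \<alpha>) (\<beta> k) = (g \<beta>) (\<alpha> k)\<close>, so for given \<open>\<alpha>\<close> and \<open>\<beta>\<close> there are at most \<open>(N / max \<alpha> \<beta>)\<^sup>2\<close> choices of
  \<open>g\<close> and \<open>k\<close>.  It matters to keep the maximum: replacing it by the geometric mean of \<open>\<alpha>\<close> and \<open>\<beta>\<close>
  would cost a second logarithm.
\<close>
lemma card_product_solutions_le:
  assumes N: "N \<ge> 1"
  shows "real (card (product_solutions N)) \<le> 2 * (real N)\<^sup>2 * (1 + ln (real N))"
proof -
  define J where "J = {1..N} \<times> {1..N}"
  define d where "d = (\<lambda>(\<alpha>, \<beta>). N div max \<alpha> \<beta> :: nat)"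
  define K where "K = (SIGMA i:J. {1..d i} \<times> {1..d i})"
  define \<phi> where "\<phi> = (\<lambda>((\<alpha>, \<beta>), g, k). (g * \<alpha>, \<beta> * k, g * \<beta>, \<alpha> * k) :: nat \<times> nat \<times> nat \<times> nat)"
  have "product_solutions N \<subseteq> \<phi> ` K"
  proof
    fix q assume "q \<in> product_solutions N"
    then obtain u v w t where q: "q = (u, v, w, t)" "1 \<le> u" "u \<le> N" "1 \<le> v" "v \<le> N"
      "1 \<le> w" "w \<le> N" "1 \<le> t" "t \<le> N" "u * v = w * t"
      by (auto simp: product_solutions_def)
    define g where "g = gcd u w"
    obtain \<alpha> \<beta> where ab: "u = g * \<alpha>" "w = g * \<beta>" "coprime \<alpha> \<beta>"
      using gcd_coprime_exists[of u w] q(2) unfolding g_def by (metis gcd_eq_0_iff mult.commute not_one_le_zero)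
    have g: "g \<ge> 1" and a1: "\<alpha> \<ge> 1" "\<beta> \<ge> 1" using ab q by (auto simp: Suc_le_eq intro!: gr0I)
    have eq: "\<alpha> * v = \<beta> * t" using q(10) ab g by simp
    then have "\<beta> dvd \<alpha> * v" by simp
    then have "\<beta> dvd v" using ab(3) by (metis coprime_commute coprime_dvd_mult_right_iff)
    then obtain k where v: "v = \<beta> * k" by auto
    have t: "t = \<alpha> * k" using eq v a1 by simp
    have k1: "k \<ge> 1" using v q by (auto simp: Suc_le_eq intro!: gr0I)
    have le: "\<alpha> \<le> N" "\<beta> \<le> N" "g \<le> N div max \<alpha> \<beta>" "k \<le> N div max \<alpha> \<beta>"
    proof -
      show "\<alpha> \<le> N" using q(3) ab g by (metis One_nat_def le_trans mult_le_mono1 nat_mult_1)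
      show "\<beta> \<le> N" using q(7) ab g by (metis One_nat_def le_trans mult_le_mono1 nat_mult_1)
      have "g * max \<alpha> \<beta> \<le> N" using q(3,7) ab by (simp add: max_def)
      then show "g \<le> N div max \<alpha> \<beta>" using a1 by (simp add: less_eq_div_iff_mult_less_eq)
      have "k * max \<alpha> \<beta> \<le> N" using q(5,9) v t by (simp add: max_def mult.commute)
      then show "k \<le> N div max \<alpha> \<beta>" using a1 by (simp add: less_eq_div_iff_mult_less_eq)
    qed
    have "((\<alpha>, \<beta>), g, k) \<in> K" using le g a1 k1 by (simp add: K_def J_def d_def)
    moreover have "q = \<phi> ((\<alpha>, \<beta>), g, k)" by (simp add: \<phi>_def q(1) ab(1,2)[symmetric] v t)
    ultimately show "q \<in> \<phi> ` K" by blast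
  qed
  moreover have finK: "finite K" by (auto simp: K_def J_def)
  ultimately have "card (product_solutions N) \<le> card (\<phi> ` K)" by (intro card_mono) auto
  also have "\<dots> \<le> card K" by (rule card_image_le[OF finK])
  also have "card K = (\<Sum>i\<in>J. d i * d i)"
    unfolding K_def by (subst card_SigmaI) (auto simp: J_def card_cartesian_product)
  finally have "real (card (product_solutions N)) \<le> (\<Sum>i\<in>J. real (d i) * real (d i))"
    using of_nat_mono by fastforce
  also have "\<dots> = (\<Sum>\<alpha>=1..N. \<Sum>\<beta>=1..N. (real (N div max \<alpha> \<beta>))\<^sup>2)"
    by (simp add: J_def d_def sum.cartesian_product power2_eq_square case_prod_beta)
  also have "\<dots> \<le> (\<Sum>\<alpha>=1..N. \<Sum>\<beta>=1..N. (if \<beta> \<le> \<alpha> then (real N / real \<alpha>)\<^sup>2 else 0) + (if \<alpha> \<le> \<beta> then (real N / real \<beta>)\<^sup>2 else 0))"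
  proof (intro sum_mono)
    fix \<alpha> \<beta> :: nat
    have "(real (N div max \<alpha> \<beta>))\<^sup>2 \<le> (real N / real (max \<alpha> \<beta>))\<^sup>2"
      by (intro power_mono of_nat_div_le_of_nat) auto
    also have "\<dots> \<le> (if \<beta> \<le> \<alpha> then (real N / real \<alpha>)\<^sup>2 else 0) + (if \<alpha> \<le> \<beta> then (real N / real \<beta>)\<^sup>2 else 0)"
      by (cases "\<beta> \<le> \<alpha>"; cases "\<alpha> \<le> \<beta>"; simp add: max_def)
    finally show "(real (N div max \<alpha> \<beta>))\<^sup>2 \<le> (if \<beta> \<le> \<alpha> then (real N / real \<alpha>)\<^sup>2 else 0) + (if \<alpha> \<le> \<beta> then (real N / real \<beta>)\<^sup>2 else 0)" .
  qed
  also have "\<dots> = (\<Sum>\<alpha>=1..N. \<Sum>\<beta>=1..N. if \<beta> \<le> \<alpha> then (real N / real \<alpha>)\<^sup>2 else 0)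
      + (\<Sum>\<beta>=1..N. \<Sum>\<alpha>=1..N. if \<alpha> \<le> \<beta> then (real N / real \<beta>)\<^sup>2 else 0)"
    unfolding sum.distrib by (rule arg_cong2[where f = "(+)", OF refl sum.swap])
  also have "\<dots> = 2 * (\<Sum>m=1..N. \<Sum>j=1..N. if j \<le> m then (real N / real m)\<^sup>2 else 0)" by simp
  also have "(\<Sum>m=1..N. \<Sum>j=1..N. if j \<le> m then (real N / real m)\<^sup>2 else 0) = (\<Sum>m=1..N. (real N)\<^sup>2 * inverse (real m))"
  proof (rule sum.cong[OF refl])
    fix m assume m: "m \<in> {1..N}"
    have "(\<Sum>j=1..N. if j \<le> m then (real N / real m)\<^sup>2 else 0) = (\<Sum>j\<in>{j \<in> {1..N}. j \<le> m}. (real N / real m)\<^sup>2)"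
      by (rule sum.inter_filter[symmetric]) simp
    also have "{j \<in> {1..N}. j \<le> m} = {1..m}" using m by auto
    also have "(\<Sum>j\<in>{1..m}. (real N / real m)\<^sup>2) = (real N)\<^sup>2 * inverse (real m)"
      using m by (simp add: power2_eq_square field_simps)
    finally show "(\<Sum>j=1..N. if j \<le> m then (real N / real m)\<^sup>2 else 0) = (real N)\<^sup>2 * inverse (real m)" .
  qed
  also have "\<dots> = (real N)\<^sup>2 * harm N" by (simp add: harm_def sum_distrib_left)
  also have "2 * ((real N)\<^sup>2 * harm N) \<le> 2 * ((real N)\<^sup>2 * (1 + ln (real N)))"
    by (intro mult_left_mono harm_le_ln N) auto
  finally show ?thesis by simp
qed

text \<open>
  The Cauchy-Schwarz inequality for the sizes of the fibres of \<open>f\<close>.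
\<close>
lemma card_squared_le_card_image_times_collisions:
  assumes "finite X"
  shows "(real (card X))\<^sup>2 \<le> real (card (f ` X)) * real (card {(x, y) \<in> X \<times> X. f x = f y})"
proof -
  define r where "r n = card {x \<in> X. f x = n}" for n
  have "card X = (\<Sum>n\<in>f ` X. r n)"
    unfolding r_def card_eq_sum using assms by (intro sum.group[symmetric]) auto
  then have "(real (card X))\<^sup>2 = (\<Sum>n\<in>f ` X. real (r n))\<^sup>2" by simp
  also have "\<dots> \<le> (\<Sum>n\<in>f ` X. (real (r n))\<^sup>2) * real (card (f ` X))"
    by (rule sum_squared_le_sum_of_squares)
  also have "(\<Sum>n\<in>f ` X. (real (r n))\<^sup>2) = real (card {(x, y) \<in> X \<times> X. f x = f y})"
  proof -
    have "{(x, y) \<in> X \<times> X. f x = f y} = (\<Union>n\<in>f ` X. {x \<in> X. f x = n} \<times> {x \<in> X. f x = n})" by auto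
    also have "card \<dots> = (\<Sum>n\<in>f ` X. card ({x \<in> X. f x = n} \<times> {x \<in> X. f x = n}))"
      using assms by (intro card_UN_disjoint) auto
    finally show ?thesis by (simp add: r_def card_cartesian_product power2_eq_square)
  qed
  finally show ?thesis by (simp add: mult.commute)
qed

text \<open>
  A coincidence \<open>a\<^sup>2 + b\<^sup>2 = c\<^sup>2 + d\<^sup>2\<close> with \<open>a > c\<close> factors as
  \<open>(a - c) (a + c) = (d - b) (d + b)\<close>, and the four factors determine \<open>a, b, c, d\<close>.
\<close>
lemma card_equal_sums_of_squares_le:
  fixes Y :: nat
  assumes Y: "Y \<ge> 1"
  defines "X \<equiv> {1..Y} \<times> {1..Y}" and "f \<equiv> \<lambda>(a, b). a\<^sup>2 + b\<^sup>2 :: nat"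
  shows "real (card {(x, y) \<in> X \<times> X. f x = f y}) \<le> (real Y)\<^sup>2 * (17 + 16 * ln (2 * real Y))"
proof -
  let ?E = "{(x, y) \<in> X \<times> X. f x = f y}"
  define E1 where "E1 = {((a, b), (c, d)) | a b c d. (a, b) \<in> X \<and> (c, d) \<in> X \<and> a > c \<and> a\<^sup>2 + b\<^sup>2 = c\<^sup>2 + d\<^sup>2}"
  have finX: "finite X" by (simp add: X_def)
  have fin: "finite (X \<times> X)" by (simp add: X_def)
  have finE1: "finite E1" by (rule finite_subset[OF _ fin]) (auto simp: E1_def)
  have sub: "?E \<subseteq> (\<lambda>x. (x, x)) ` X \<union> E1 \<union> prod.swap ` E1"
  proof
    fix z assume "z \<in> ?E"
    then obtain a b c d where z: "z = ((a, b), (c, d))" "(a, b) \<in> X" "(c, d) \<in> X" "a\<^sup>2 + b\<^sup>2 = c\<^sup>2 + d\<^sup>2"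
      by (auto simp: f_def)
    consider "a = c" | "a > c" | "a < c" by linarith
    then show "z \<in> (\<lambda>x. (x, x)) ` X \<union> E1 \<union> prod.swap ` E1"
    proof cases
      case 1
      then have "b = d" using z(4) by simp
      then show ?thesis using z 1 by auto
    next
      case 2
      then show ?thesis using z by (auto simp: E1_def)
    next
      case 3
      then have "((c, d), (a, b)) \<in> E1" using z by (auto simp: E1_def)
      then show ?thesis using z by force
    qed
  qed
  \<comment> \<open>As \<open>a > c\<close> forces \<open>b < d\<close>, neither difference truncates.\<close>
  define \<psi> where "\<psi> = (\<lambda>((a, b), (c, d)). (a - c, a + c, d - b, d + b) :: nat \<times> nat \<times> nat \<times> nat)"
  have gap: "b < d" if "a > c" "a\<^sup>2 + b\<^sup>2 = c\<^sup>2 + d\<^sup>2" for a b c d :: nat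
  proof -
    have "c\<^sup>2 < a\<^sup>2" using that by (simp add: power_strict_mono)
    then have "b\<^sup>2 < d\<^sup>2" using that by linarith
    then show ?thesis by (rule power_less_imp_less_base) simp
  qed
  have "inj_on \<psi> E1"
  proof (rule inj_onI)
    fix z z' assume "z \<in> E1" "z' \<in> E1" "\<psi> z = \<psi> z'"
    obtain a b c d where z: "z = ((a, b), (c, d))" "a > c" "a\<^sup>2 + b\<^sup>2 = c\<^sup>2 + d\<^sup>2"
      using \<open>z \<in> E1\<close> unfolding E1_def by blast
    obtain a' b' c' d' where z': "z' = ((a', b'), (c', d'))" "a' > c'" "a'\<^sup>2 + b'\<^sup>2 = c'\<^sup>2 + d'\<^sup>2"
      using \<open>z' \<in> E1\<close> unfolding E1_def by blast
    have bd: "b < d" "b' < d'" using gap z z' by blast+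
    have "a - c = a' - c'" "a + c = a' + c'" "d - b = d' - b'" "d + b = d' + b'"
      using \<open>\<psi> z = \<psi> z'\<close> by (simp_all add: \<psi>_def z(1) z'(1))
    then have "a = a'" "c = c'" "b = b'" "d = d'" using bd z(2) z'(2) by linarith+
    then show "z = z'" by (simp add: z(1) z'(1))
  qed
  moreover have "\<psi> ` E1 \<subseteq> product_solutions (2 * Y)"
  proof
    fix q assume "q \<in> \<psi> ` E1"
    then obtain z where z: "z \<in> E1" "q = \<psi> z" by blast
    then obtain a b c d where E1: "z = ((a, b), (c, d))" "(a, b) \<in> X" "(c, d) \<in> X" "a > c"
      "a\<^sup>2 + b\<^sup>2 = c\<^sup>2 + d\<^sup>2" unfolding E1_def by blast
    then have q: "q = (a - c, a + c, d - b, d + b)" "(a, b) \<in> X" "(c, d) \<in> X" "a > c"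
      "a\<^sup>2 + b\<^sup>2 = c\<^sup>2 + d\<^sup>2" by (simp_all add: z(2) \<psi>_def)
    have bd: "b < d" using gap q by blast
    have "int (a - c) * int (a + c) = int (d - b) * int (d + b)"
    proof -
      have "int a ^ 2 + int b ^ 2 = int c ^ 2 + int d ^ 2" using q(5) by (metis of_nat_add of_nat_power)
      then show ?thesis using q(4) bd by (simp add: of_nat_diff algebra_simps power2_eq_square)
    qed
    then have "(a - c) * (a + c) = (d - b) * (d + b)" by (metis of_nat_eq_iff of_nat_mult)
    then show "q \<in> product_solutions (2 * Y)"
      using q bd by (auto simp: product_solutions_def X_def)
  qed
  ultimately have E1: "card E1 \<le> card (product_solutions (2 * Y))"
    using finite_product_solutions by (rule card_inj_on_le)
  have "card ?E \<le> card ((\<lambda>x. (x, x)) ` X \<union> E1 \<union> prod.swap ` E1)"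
    using sub finX finE1 by (intro card_mono) auto
  also have "\<dots> \<le> card ((\<lambda>x. (x, x)) ` X) + card E1 + card (prod.swap ` E1)"
    by (meson add_mono card_Un_le le_refl order_trans)
  also have "\<dots> \<le> card X + card E1 + card E1"
    by (intro add_mono card_image_le finX finE1 le_refl)
  finally have "card ?E \<le> Y\<^sup>2 + 2 * card (product_solutions (2 * Y))"
    using E1 by (simp add: X_def card_cartesian_product power2_eq_square)
  then have "real (card ?E) \<le> real (Y\<^sup>2 + 2 * card (product_solutions (2 * Y)))" by (rule of_nat_mono)
  also have "\<dots> \<le> (real Y)\<^sup>2 + 2 * (2 * (2 * real Y)\<^sup>2 * (1 + ln (2 * real Y)))"
    using card_product_solutions_le[of "2 * Y"] Y by simp
  also have "\<dots> = (real Y)\<^sup>2 * (17 + 16 * ln (2 * real Y))"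
    by (simp add: algebra_simps power2_eq_square)
  finally show ?thesis .
qed

lemma sums_of_two_squares_lower_bound:
  "\<exists>c>0. eventually (\<lambda>x. c * x / ln x \<le> counting sums_of_two_squares x) at_top"
proof (intro exI conjI)
  have "eventually (\<lambda>x::real. ln x \<ge> 5) at_top"
    by real_asymp
  then show "eventually (\<lambda>x. (1/100) * x / ln x \<le> counting sums_of_two_squares x) at_top"
    using eventually_ge_at_top[of 400]
  proof eventually_elim
    case (elim x)
    \<comment> \<open>Then \<open>a\<^sup>2 + b\<^sup>2 \<le> x / 2\<close> for \<open>a, b \<le> Y\<close>.\<close>
    define Y where "Y = nat \<lfloor>sqrt x / 2\<rfloor>"
    have x0: "0 \<le> x" using elim by linarith
    have s: "sqrt x / 2 \<ge> 1" "sqrt x \<le> x" using elim by (simp_all add: real_le_rsqrt real_le_lsqrt power2_eq_square)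
    have Y: "Y \<ge> 1" "real Y \<le> sqrt x / 2" "sqrt x / 2 - 1 \<le> real Y"
      unfolding Y_def using s by linarith+
    define X where "X = {1..Y} \<times> {1..Y}"
    define f where "f = (\<lambda>(a, b). a\<^sup>2 + b\<^sup>2 :: nat)"
    have "(real (card X))\<^sup>2 \<le> real (card (f ` X)) * real (card {(x, y) \<in> X \<times> X. f x = f y})"
      by (rule card_squared_le_card_image_times_collisions) (simp add: X_def)
    also have "\<dots> \<le> real (card (f ` X)) * ((real Y)\<^sup>2 * (17 + 16 * ln (2 * real Y)))"
      unfolding X_def f_def by (intro mult_left_mono card_equal_sums_of_squares_le Y) auto
    finally have "(real Y)\<^sup>2 * (real Y)\<^sup>2 \<le> (real Y)\<^sup>2 * (real (card (f ` X)) * (17 + 16 * ln (2 * real Y)))"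
      by (simp add: X_def card_cartesian_product power2_eq_square mult_ac)
    then have "(real Y)\<^sup>2 \<le> real (card (f ` X)) * (17 + 16 * ln (2 * real Y))"
      using Y by (subst (asm) mult_le_cancel_left_pos) auto
    moreover have l: "17 + 16 * ln (2 * real Y) > 0"
    proof -
      have "ln (2 * real Y) \<ge> 0" using Y by simp
      then show ?thesis by linarith
    qed
    ultimately have "(real Y)\<^sup>2 / (17 + 16 * ln (2 * real Y)) \<le> real (card (f ` X))"
      by (simp add: divide_le_eq)
    moreover have "(sqrt x / 2 - 1)\<^sup>2 / (17 + 16 * ln x) \<le> (real Y)\<^sup>2 / (17 + 16 * ln (2 * real Y))"
      using Y s l by (intro frac_le power_mono add_left_mono mult_left_mono ln_mono) auto
    moreover have "(1/100) * x / ln x \<le> (sqrt x / 2 - 1)\<^sup>2 / (17 + 16 * ln x)"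
    proof -
      have "20 \<le> sqrt x" using elim by (simp add: real_le_rsqrt)
      then have "(9/20 * sqrt x)\<^sup>2 \<le> (sqrt x / 2 - 1)\<^sup>2" using x0 by (intro power_mono) auto
      moreover have "(9/20 * sqrt x)\<^sup>2 = 81/400 * x" using x0 by (simp add: power_mult_distrib power_divide)
      ultimately have "x / 5 \<le> (sqrt x / 2 - 1)\<^sup>2" using elim by linarith
      then have "(x / 5) / (20 * ln x) \<le> (sqrt x / 2 - 1)\<^sup>2 / (17 + 16 * ln x)"
        using elim by (intro frac_le) auto
      then show ?thesis by simp
    qed
    moreover have "real (card (f ` X)) \<le> counting sums_of_two_squares x"
      unfolding counting_def
    proof (intro of_nat_mono card_mono subsetI)
      have "{s \<in> sums_of_two_squares. 1 \<le> real s \<and> real s \<le> x} \<subseteq> {..nat \<lfloor>x\<rfloor>}"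
        by (auto simp: le_nat_floor)
      then show "finite {s \<in> sums_of_two_squares. 1 \<le> real s \<and> real s \<le> x}"
        by (rule finite_subset) simp
      fix n assume "n \<in> f ` X"
      then obtain a b where ab: "1 \<le> a" "a \<le> Y" "1 \<le> b" "b \<le> Y" "n = a\<^sup>2 + b\<^sup>2"
        by (auto simp: X_def f_def)
      have "real n \<le> (real Y)\<^sup>2 + (real Y)\<^sup>2"
        unfolding ab(5) of_nat_add of_nat_power using ab by (intro add_mono power_mono) auto
      also have "\<dots> \<le> (sqrt x / 2)\<^sup>2 + (sqrt x / 2)\<^sup>2"
        using Y by (intro add_mono power_mono) auto
      also have "\<dots> \<le> x" using x0 by (simp add: power_divide)
      finally have "real n \<le> x" .
      moreover have "int n = (int a)\<^sup>2 + (int b)\<^sup>2" using ab by simp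
      moreover have "1 \<le> n" using ab by (simp add: Suc_le_eq)
      ultimately show "n \<in> {s \<in> sums_of_two_squares. 1 \<le> real s \<and> real s \<le> x}"
        unfolding sums_of_two_squares_def by auto
    qed
    ultimately show ?case using elim by linarith
  qed
qed simp

section \<open>Indices and gaps of an infinite set of natural numbers\<close>
definition close_triples :: "nat set \<Rightarrow> real \<Rightarrow> real \<Rightarrow> nat set" where
  "close_triples S x h = {k. 1 \<le> k \<and> nth_element S k \<le> x \<and> nth_element S (k + 2) - nth_element S k \<le> h}"

definition indices_upto :: "nat set \<Rightarrow> real \<Rightarrow> nat set" where
  "indices_upto S x = {k. 1 \<le> k \<and> nth_element S k \<le> x}"

lemma sum_two_step_gaps:
  fixes f :: "nat \<Rightarrow> real"
  shows "(\<Sum>k=1..m. f (k + 2) - f k) = f (m + 2) + f (m + 1) - f 2 - f 1"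
proof (induction m)
  case 0
  show ?case by (simp add: numeral_2_eq_2)
next
  case (Suc m)
  have "(\<Sum>k=1..Suc m. f (k + 2) - f k) = (\<Sum>k=1..m. f (k + 2) - f k) + (f (Suc m + 2) - f (Suc m))"
    by (rule sum.cl_ivl_Suc[THEN trans]) simp
  then show ?case using Suc.IH by simp
qed

locale infinite_nat_set =
  fixes S :: "nat set"
  assumes infinite_S: "infinite S"
begin

abbreviation (input) s :: "nat \<Rightarrow> real" where "s \<equiv> nth_element S"

lemma enumerate_less: "i < j \<Longrightarrow> enumerate S i < enumerate S j"
  using strict_mono_enumerate[OF infinite_S] by (simp add: strict_mono_def)

lemma enumerate_le: "i \<le> j \<Longrightarrow> enumerate S i \<le> enumerate S j"
  using strict_mono_enumerate[OF infinite_S] by (simp add: strict_mono_less_eq)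

lemma s_mono: "i \<le> j \<Longrightarrow> s i \<le> s j"
  using enumerate_le[OF diff_le_mono[of i j 1]] by (simp add: nth_element_def)

lemma s_ge: "real k - 1 \<le> s k"
  using strict_mono_imp_increasing[OF strict_mono_enumerate[OF infinite_S], of "k - 1"]
  by (simp add: nth_element_def)

lemma inj_index: "inj_on (\<lambda>k. enumerate S (k - 1)) {k. 1 \<le> k}"
proof (rule inj_onI)
  fix i j assume ij: "i \<in> {k. 1 \<le> k}" "j \<in> {k. 1 \<le> k}" "enumerate S (i - 1) = enumerate S (j - 1)"
  then have "i - 1 = j - 1" using enumerate_less by (metis less_irrefl linorder_neqE_nat)
  then show "i = j" using ij by auto
qed

lemma finite_elements_upto: "finite {n \<in> S. real n \<le> x}"
  by (rule finite_subset[of _ "{..nat \<lfloor>x\<rfloor>}"]) (auto simp: le_nat_floor)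

lemma image_indices_upto: "(\<lambda>k. enumerate S (k - 1)) ` indices_upto S x = {n \<in> S. real n \<le> x}"
proof (intro equalityI subsetI)
  fix n assume n: "n \<in> {n \<in> S. real n \<le> x}"
  then have "n \<in> range (enumerate S)" using range_enumerate[OF infinite_S] by simp
  then obtain i where i: "n = enumerate S i" by blast
  then have "Suc i \<in> indices_upto S x" using n by (simp add: indices_upto_def nth_element_def)
  moreover have "n = enumerate S (Suc i - 1)" using i by simp
  ultimately show "n \<in> (\<lambda>k. enumerate S (k - 1)) ` indices_upto S x" by (rule rev_image_eqI)
next
  fix n assume "n \<in> (\<lambda>k. enumerate S (k - 1)) ` indices_upto S x"
  then obtain k where "k \<in> indices_upto S x" "n = enumerate S (k - 1)" by blast
  then show "n \<in> {n \<in> S. real n \<le> x}"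
    by (simp add: indices_upto_def nth_element_def enumerate_in_set infinite_S)
qed

lemma finite_indices_upto: "finite (indices_upto S x)"
proof (rule finite_imageD)
  show "finite ((\<lambda>k. enumerate S (k - 1)) ` indices_upto S x)"
    unfolding image_indices_upto by (rule finite_elements_upto)
  show "inj_on (\<lambda>k. enumerate S (k - 1)) (indices_upto S x)"
    by (rule inj_on_subset[OF inj_index]) (auto simp: indices_upto_def)
qed

text \<open>
  The two counts differ exactly when \<open>0 \<in> S\<close> and \<open>x \<ge> 0\<close>, since \<open>counting\<close> starts at 1.
\<close>
lemma card_indices_upto:
  "counting S x \<le> real (card (indices_upto S x))" "real (card (indices_upto S x)) \<le> counting S x + 1"
proof -
  have "card (indices_upto S x) = card {n \<in> S. real n \<le> x}"
    unfolding image_indices_upto[symmetric]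
    by (intro card_image[symmetric] inj_on_subset[OF inj_index]) (auto simp: indices_upto_def)
  moreover have "card {n \<in> S. 1 \<le> real n \<and> real n \<le> x} \<le> card {n \<in> S. real n \<le> x}"
    by (intro card_mono finite_elements_upto) auto
  moreover have "card {n \<in> S. real n \<le> x} \<le> card (insert 0 {n \<in> S. 1 \<le> real n \<and> real n \<le> x})"
    by (intro card_mono) (auto intro: finite_subset[OF _ finite_elements_upto])
  moreover have "card (insert 0 {n \<in> S. 1 \<le> real n \<and> real n \<le> x}) \<le> Suc (card {n \<in> S. 1 \<le> real n \<and> real n \<le> x})"
    by (rule card_insert_le_m1) auto
  ultimately show "counting S x \<le> real (card (indices_upto S x))" "real (card (indices_upto S x)) \<le> counting S x + 1"
    unfolding counting_def by linarith+
qed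

lemma indices_upto_eq: "indices_upto S x = {1..card (indices_upto S x)}"
proof -
  let ?K = "indices_upto S x"
  have down: "j \<in> ?K" if "1 \<le> j" "j \<le> k" "k \<in> ?K" for j k
    using that s_mono[of j k] by (auto simp: indices_upto_def)
  show ?thesis
  proof (cases "?K = {}")
    case False
    define M where "M = Max ?K"
    have "M \<in> ?K" "\<And>k. k \<in> ?K \<Longrightarrow> k \<le> M" unfolding M_def using False finite_indices_upto by auto
    then have "?K = {1..M}" using down by (auto simp: indices_upto_def)
    then show ?thesis by simp
  qed auto
qed

lemma close_triples_subset: "close_triples S x h \<subseteq> indices_upto S x"
  by (auto simp: close_triples_def indices_upto_def)

lemma finite_close_triples: "finite (close_triples S x h)"
  by (rule finite_subset[OF close_triples_subset finite_indices_upto])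

end

section \<open>Consequences for a set that passes the sieve\<close>
locale sieved_set =
  fixes S :: "nat set" and c :: real
  assumes avoids: "avoids_exact_division S"
    and c_pos: "c > 0"
    and lower_bound: "eventually (\<lambda>x. c * x / ln x \<le> counting S x) at_top"

lemma (in sieved_set) infinite: "infinite S"
proof
  assume fin: "finite S"
  have "filterlim (\<lambda>x::real. x / ln x) at_top at_top" by real_asymp
  then have "eventually (\<lambda>x::real. real (card S) / c < x / ln x) at_top"
    by (simp add: filterlim_at_top_dense)
  then have "eventually (\<lambda>x::real. False) at_top"
    using lower_bound
  proof eventually_elim
    case (elim x)
    have "counting S x \<le> real (card S)"
      unfolding counting_def by (intro of_nat_mono card_mono fin) auto
    moreover have "real (card S) < c * x / ln x" using elim c_pos by (simp add: divide_less_eq mult.commute)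
    ultimately show False using elim by linarith
  qed
  then show False by simp
qed

sublocale sieved_set \<subseteq> infinite_nat_set
  by unfold_locales (rule infinite)

context sieved_set
begin

lemma card_close_triples_eventually_le:
  "eventually (\<lambda>x. real (card (close_triples S x (ln (ln x)))) \<le> x / ln x powr (6/5)) at_top"
  using few_close_triples[OF avoids]
proof eventually_elim
  case (elim x)
  let ?T = "{n \<in> S. real n \<le> x \<and> (\<exists>a b. 0 < a \<and> a < b \<and> real b \<le> ln (ln x) \<and> n + a \<in> S \<and> n + b \<in> S)}"
  have "card (close_triples S x (ln (ln x))) \<le> card ?T"
  proof (rule card_inj_on_le)
    show "inj_on (\<lambda>k. enumerate S (k - 1)) (close_triples S x (ln (ln x)))"
      by (rule inj_on_subset[OF inj_index]) (auto simp: close_triples_def)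
    show "finite ?T" by (rule finite_subset[OF _ finite_elements_upto[of x]]) auto
    show "(\<lambda>k. enumerate S (k - 1)) ` close_triples S x (ln (ln x)) \<subseteq> ?T"
    proof (rule image_subsetI)
      fix k assume k: "k \<in> close_triples S x (ln (ln x))"
      then have k1: "1 \<le> k" by (simp add: close_triples_def)
      define n where "n = enumerate S (k - 1)"
      have less: "n < enumerate S k" "enumerate S k < enumerate S (k + 1)"
        using k1 enumerate_less by (auto simp: n_def)
      define a where "a = enumerate S k - n"
      define b where "b = enumerate S (k + 1) - n"
      have ab: "n + a = enumerate S k" "n + b = enumerate S (k + 1)" "0 < a" "a < b"
        using less by (auto simp: a_def b_def)
      have n: "real n \<le> x" and "real (n + b) - real n \<le> ln (ln x)"
        unfolding ab(2) using k by (simp_all add: close_triples_def nth_element_def n_def)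
      then have "real b \<le> ln (ln x)" by simp
      moreover have "n \<in> S" "n + a \<in> S" "n + b \<in> S"
        unfolding ab(1,2) by (simp_all add: enumerate_in_set infinite_S n_def)
      ultimately have "n \<in> ?T" using n ab(3,4) by blast
      then show "enumerate S (k - 1) \<in> ?T" by (simp only: n_def)
    qed
  qed
  then show ?case using elim by linarith
qed

text \<open>
  The form in which \<open>S(x) \<ge> c x / ln x\<close> is used: comparison functions that are \<open>o(x / ln x)\<close> eventually
  lie below \<open>S(x)\<close>.
\<close>
lemma counting_eventually_ge:
  assumes "((\<lambda>x. u x * ln x / x) \<longlongrightarrow> 0) at_top"
  shows "eventually (\<lambda>x. u x \<le> counting S x) at_top"
proof -
  have "eventually (\<lambda>x. u x * ln x / x < c) at_top" by (rule order_tendstoD(2)[OF assms c_pos])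
  then show ?thesis using lower_bound eventually_gt_at_top[of 1]
  proof eventually_elim
    case (elim x)
    then have "u x \<le> c * x / ln x" by (simp add: divide_less_eq le_divide_eq)
    then show ?case using elim by linarith
  qed
qed

lemma eventually_few_close_triples:
  "eventually (\<lambda>x. ln (ln x) \<ge> 2 \<and> counting S x > 0 \<and> sqrt x \<le> counting S x / (ln (ln x))\<^sup>2 \<and>
     real (card (close_triples S x (ln (ln x)))) \<le> counting S x / (ln (ln x))\<^sup>2) at_top"
proof -
  have "((\<lambda>x::real. ((ln (ln x))\<^sup>2 * sqrt x) * ln x / x) \<longlongrightarrow> 0) at_top" by real_asymp
  note a = counting_eventually_ge[OF this]
  have "((\<lambda>x::real. ((ln (ln x))\<^sup>2 * (x / ln x powr (6/5))) * ln x / x) \<longlongrightarrow> 0) at_top" by real_asymp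
  note b = counting_eventually_ge[OF this]
  have "eventually (\<lambda>x::real. ln (ln x) \<ge> 2) at_top" by real_asymp
  then show ?thesis using a b card_close_triples_eventually_le eventually_gt_at_top[of 1]
  proof eventually_elim
    case (elim x)
    have "ln (ln x) > 0" using elim by linarith
    then have L: "(ln (ln x))\<^sup>2 > 0" by (rule zero_less_power)
    have "sqrt x \<le> counting S x / (ln (ln x))\<^sup>2" using elim L by (simp add: le_divide_eq mult.commute)
    moreover have "x / ln x powr (6/5) \<le> counting S x / (ln (ln x))\<^sup>2"
      using elim L by (simp add: le_divide_eq mult.commute)
    moreover have "(ln (ln x))\<^sup>2 * sqrt x > 0" using L elim by simp
    ultimately show ?case using elim by linarith
  qed
qed

text \<open>
  Every element up to \<open>x\<close>, except the last two, either starts a close triple or starts a two-step gap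
  longer than \<open>ln (ln x)\<close>.  The two-step gaps telescope to at most \<open>2 x\<close>, so there are at most
  \<open>2 x / ln (ln x)\<close> long ones.
\<close>
lemma counting_eventually_le:
  "eventually (\<lambda>x. counting S x \<le> 5 * x / ln (ln x)) at_top"
proof -
  have "eventually (\<lambda>x::real. x / ln x powr (6/5) + 2 + 2 * x / ln (ln x) \<le> 5 * x / ln (ln x)) at_top"
    by real_asymp
  then show ?thesis using card_close_triples_eventually_le eventually_few_close_triples eventually_gt_at_top[of 1]
  proof eventually_elim
    case (elim x)
    define L where "L = ln (ln x)"
    define m where "m = card (indices_upto S x)"
    define B where "B = {k \<in> {1..m - 2}. s (k + 2) - s k > L}"
    have K: "indices_upto S x = {1..m}" unfolding m_def by (rule indices_upto_eq)
    have L: "L \<ge> 2" using elim by (simp add: L_def)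
    have "L * real (card B) \<le> 2 * x"
    proof (cases "m \<ge> 3")
      case True
      have nn: "0 \<le> s 1" "0 \<le> s 2" by (simp_all add: nth_element_def)
      have "m \<in> indices_upto S x" using K True by simp
      then have sm: "s m \<le> x" by (simp add: indices_upto_def)
      have "L * real (card B) = (\<Sum>k\<in>B. L)" by simp
      also have "\<dots> \<le> (\<Sum>k\<in>B. s (k + 2) - s k)" by (intro sum_mono) (auto simp: B_def)
      also have "\<dots> \<le> (\<Sum>k=1..m - 2. s (k + 2) - s k)"
        by (intro sum_mono2) (auto simp: B_def s_mono)
      also have "\<dots> = s m + s (m - 1) - s 2 - s 1"
      proof -
        have "m - 2 + 2 = m" "m - 2 + 1 = m - 1" using True by auto
        then show ?thesis unfolding sum_two_step_gaps by simp
      qed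
      also have "\<dots> \<le> 2 * x" using sm s_mono[of "m - 1" m] nn by simp
      finally show ?thesis .
    next
      case False
      then have "B = {}" by (auto simp: B_def)
      then show ?thesis using elim by simp
    qed
    then have B: "real (card B) \<le> 2 * x / L" using L by (simp add: le_divide_eq mult.commute)
    have "indices_upto S x \<subseteq> close_triples S x L \<union> B \<union> {m - 1, m}"
    proof
      fix k assume k: "k \<in> indices_upto S x"
      then have "1 \<le> k" "k \<le> m" using K by auto
      then show "k \<in> close_triples S x L \<union> B \<union> {m - 1, m}"
        using k by (auto simp: close_triples_def B_def indices_upto_def)
    qed
    then have "card (indices_upto S x) \<le> card (close_triples S x L \<union> B \<union> {m - 1, m})"
      by (intro card_mono) (auto simp: finite_close_triples B_def)
    also have "\<dots> \<le> card (close_triples S x L) + card B + card {m - 1, m}"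
      by (meson add_mono card_Un_le le_refl order_trans)
    also have "card {m - 1, m} \<le> 2" by (simp add: card_insert_if)
    finally have "real (card (indices_upto S x)) \<le> real (card (close_triples S x L)) + real (card B) + 2"
      by linarith
    then show ?case using elim B card_indices_upto(1)[of x] unfolding L_def by linarith
  qed
qed

lemma mean_spacing_tendsto: "filterlim (mean_spacing S) at_top at_top"
proof (rule filterlim_at_top_mono)
  show "filterlim (\<lambda>x::real. ln (ln x) / 5) at_top at_top" by real_asymp
  show "eventually (\<lambda>x. ln (ln x) / 5 \<le> mean_spacing S x) at_top"
    using counting_eventually_le eventually_few_close_triples
  proof eventually_elim
    case (elim x)
    define L where "L = ln (ln x)"
    define C where "C = counting S x"
    have "L \<ge> 2" "C > 0" "C \<le> 5 * x / L" using elim by (simp_all add: L_def C_def)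
    then have "L / 5 * C \<le> x" by (simp add: le_divide_eq mult.commute)
    with \<open>C > 0\<close> have "L / 5 \<le> x / C" by (simp add: le_divide_eq)
    then show ?case by (simp add: mean_spacing_def L_def C_def)
  qed
qed

lemma ln_mean_spacing_bounds:
  "eventually (\<lambda>x. 0 < ln (mean_spacing S x) \<and> ln (mean_spacing S x) \<le> 2 * ln (ln x)) at_top"
proof -
  have "eventually (\<lambda>x. mean_spacing S x > 1) at_top"
    using mean_spacing_tendsto by (rule filterlim_at_top_dense[THEN iffD1, rule_format])
  moreover have "((\<lambda>x::real. (x / (ln x)\<^sup>2) * ln x / x) \<longlongrightarrow> 0) at_top" by real_asymp
  note counting_eventually_ge[OF this]
  ultimately show ?thesis using eventually_few_close_triples eventually_gt_at_top[of 1]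
  proof eventually_elim
    case (elim x)
    have "mean_spacing S x \<le> (ln x)\<^sup>2"
      using elim unfolding mean_spacing_def by (simp add: divide_le_eq mult.commute)
    then have "ln (mean_spacing S x) \<le> ln ((ln x)\<^sup>2)" using elim by (intro ln_mono) auto
    also have "\<dots> = 2 * ln (ln x)" using elim by (simp add: ln_realpow)
    finally show ?case using elim by simp
  qed
qed

text \<open>
  A saving of \<open>(ln (ln x))\<^sup>2\<close> over \<open>S(x)\<close> is more than enough, because \<open>ln (f(x))\<close> has at most the order
  of \<open>ln (ln x)\<close>.
\<close>
lemma smallo_counting_over_ln_mean_spacing:
  assumes u: "eventually (\<lambda>x. \<bar>u x\<bar> \<le> B * counting S x / (ln (ln x))\<^sup>2) at_top"
  shows "u \<in> o[at_top](\<lambda>x. counting S x / ln (mean_spacing S x))"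
proof (rule landau_o.smallI)
  fix \<epsilon> :: real assume \<epsilon>: "\<epsilon> > 0"
  have "filterlim (\<lambda>x::real. ln (ln x)) at_top at_top" by real_asymp
  then have "eventually (\<lambda>x::real. ln (ln x) \<ge> 2 * B / \<epsilon>) at_top"
    by (simp add: filterlim_at_top)
  with u eventually_few_close_triples ln_mean_spacing_bounds
  show "eventually (\<lambda>x. norm (u x) \<le> \<epsilon> * norm (counting S x / ln (mean_spacing S x))) at_top"
  proof eventually_elim
    case (elim x)
    define L where "L = ln (ln x)"
    define C where "C = counting S x"
    have L: "L \<ge> 2" "2 * B \<le> \<epsilon> * L" and C: "C > 0" and f: "0 < ln (mean_spacing S x)" "ln (mean_spacing S x) \<le> 2 * L"
      using elim \<epsilon> by (auto simp: L_def C_def divide_le_eq mult.commute)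
    have "\<bar>u x\<bar> \<le> B * C / L\<^sup>2" using elim by (simp add: L_def C_def)
    also have "\<dots> \<le> (\<epsilon> * L / 2) * C / L\<^sup>2"
      using L C by (intro divide_right_mono mult_right_mono) auto
    also have "\<dots> = \<epsilon> * (C / (2 * L))" using L by (simp add: power2_eq_square)
    also have "\<dots> \<le> \<epsilon> * (C / ln (mean_spacing S x))"
      using \<epsilon> f C L by (intro mult_left_mono divide_left_mono) auto
    finally show ?case using C f by (simp add: C_def)
  qed
qed

lemma close_triples_smallo:
  "(\<lambda>x. real (card (close_triples S x h))) \<in> o[at_top](\<lambda>x. counting S x / ln (mean_spacing S x))"
proof (rule smallo_counting_over_ln_mean_spacing[where B = 1])
  have "filterlim (\<lambda>x::real. ln (ln x)) at_top at_top" by real_asymp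
  then have "eventually (\<lambda>x::real. h \<le> ln (ln x)) at_top" by (simp add: filterlim_at_top)
  with eventually_few_close_triples
  show "eventually (\<lambda>x. \<bar>real (card (close_triples S x h))\<bar> \<le> 1 * counting S x / (ln (ln x))\<^sup>2) at_top"
  proof eventually_elim
    case (elim x)
    have "card (close_triples S x h) \<le> card (close_triples S x (ln (ln x)))"
      using elim by (intro card_mono finite_close_triples) (auto simp: close_triples_def)
    then show ?case using elim by simp
  qed
qed

lemma half_gap_ge_1: "n \<ge> 2 \<Longrightarrow> half_gap S n \<ge> 1"
proof -
  assume n: "n \<ge> 2"
  have "enumerate S (n - 1 - 1) < enumerate S (n - 1)" "enumerate S (n - 1) < enumerate S n"
    using n by (auto intro: enumerate_less)
  then have "real (enumerate S (n - 1 - 1)) + 2 \<le> real (enumerate S n)" by linarith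
  then show ?thesis by (simp add: half_gap_def nth_element_def)
qed

lemma half_gap_eq: "k \<ge> 1 \<Longrightarrow> half_gap S (k + 1) = (s (k + 2) - s k) / 2"
  by (simp add: half_gap_def)

context
  fixes \<iota> d :: real and \<delta> :: "nat \<Rightarrow> real"
  assumes \<iota>: "\<iota> > 0" and \<delta>_pos: "\<And>n. n \<ge> 1 \<Longrightarrow> \<delta> n > 0" and d: "d > 0"
    and \<delta>_ge: "\<And>n. n \<ge> 3 \<Longrightarrow> \<delta> n \<ge> d * min (half_gap S n) (ln (ln (real n)) powr \<iota>)"
begin

lemma \<delta>_bounded_below: "\<exists>c>0. \<forall>n\<ge>1. c \<le> \<delta> n"
proof -
  define w where "w = d * min 1 (ln (ln 3) powr \<iota>)"
  have "exp 1 < (3::real)" using exp_le e_less_272 by simp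
  then have "ln (exp 1) < ln (3::real)" by (subst ln_less_cancel_iff) auto
  then have "1 < ln (3::real)" by simp
  then have ll3: "ln (ln (3::real)) > 0" by simp
  have w: "w > 0" using d ll3 by (simp add: w_def)
  have "w \<le> \<delta> n" if n: "n \<ge> 3" for n
  proof -
    have "ln (ln 3) \<le> ln (ln (real n))" using n ll3 by (intro ln_mono) auto
    then have "ln (ln 3) powr \<iota> \<le> ln (ln (real n)) powr \<iota>" using \<iota> ll3 by (intro powr_mono2) auto
    then have "w \<le> d * min (half_gap S n) (ln (ln (real n)) powr \<iota>)"
      unfolding w_def using d half_gap_ge_1[of n] n by (intro mult_left_mono) auto
    then show ?thesis using \<delta>_ge[OF n] by linarith
  qed
  then have "min w (min (\<delta> 1) (\<delta> 2)) \<le> \<delta> n" if "n \<ge> 1" for n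
  proof -
    have "n = 1 \<or> n = 2 \<or> n \<ge> 3" using that by presburger
    then show ?thesis using \<open>\<And>n. n \<ge> 3 \<Longrightarrow> w \<le> \<delta> n\<close> by (auto simp: min_le_iff_disj)
  qed
  moreover have "min w (min (\<delta> 1) (\<delta> 2)) > 0" using w \<delta>_pos by simp
  ultimately show ?thesis by blast
qed

text \<open>
  Counting indices up to \<open>x\<close> means counting elements up to \<open>X x\<close>, the element with index \<open>\<lfloor>x\<rfloor>\<close>.  Once
  \<open>(ln (ln n)) powr \<iota>\<close> exceeds \<open>2 / d\<close>, the value \<open>\<delta> n < 2\<close> can only come from a two-step gap below
  \<open>4 / d\<close>, and these are rare.
\<close>
lemma \<delta>_small_rare: "(\<lambda>x. real (card {n. 1 \<le> n \<and> real n \<le> x \<and> \<not> \<delta> n \<ge> 2})) \<in> o[at_top](\<lambda>x. x)"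
proof (rule landau_o.smallI)
  fix \<epsilon> :: real assume \<epsilon>: "\<epsilon> > 0"
  have "filterlim (\<lambda>n::nat. ln (ln (real n)) powr \<iota>) at_top sequentially" using \<iota> by real_asymp
  then have "eventually (\<lambda>n::nat. 2 / d \<le> ln (ln (real n)) powr \<iota>) sequentially"
    by (simp add: filterlim_at_top)
  then obtain N0 where N0: "\<And>n. n \<ge> N0 \<Longrightarrow> 2 / d \<le> ln (ln (real n)) powr \<iota>"
    by (auto simp: eventually_sequentially)
  define N where "N = max N0 3"
  define X where "X x = s (nat \<lfloor>x\<rfloor>)" for x :: real
  have X: "filterlim X at_top at_top"
  proof (rule filterlim_at_top_mono)
    show "filterlim (\<lambda>x::real. x - 2) at_top at_top" by real_asymp
    show "eventually (\<lambda>x. x - 2 \<le> X x) at_top"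
      using eventually_ge_at_top[of 1]
    proof eventually_elim
      case (elim x)
      then have "x - 2 \<le> real (nat \<lfloor>x\<rfloor>) - 1" by linarith
      then show ?case unfolding X_def using s_ge[of "nat \<lfloor>x\<rfloor>"] by linarith
    qed
  qed
  have "filterlim (\<lambda>x::real. (ln (ln x))\<^sup>2) at_top at_top" by real_asymp
  then have "eventually (\<lambda>y::real. (ln (ln y))\<^sup>2 \<ge> 2 / \<epsilon>) at_top" "eventually (\<lambda>y::real. ln (ln y) \<ge> 4 / d) at_top"
    using filterlim_at_top[of "\<lambda>x::real. ln (ln x)" at_top] by (simp_all add: filterlim_at_top) real_asymp
  from eventually_conj[OF eventually_few_close_triples eventually_conj[OF this]]
  have ev: "eventually (\<lambda>x. ln (ln (X x)) \<ge> 2 \<and> real (card (close_triples S (X x) (ln (ln (X x))))) \<le> counting S (X x) / (ln (ln (X x)))\<^sup>2 \<and>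
      (ln (ln (X x)))\<^sup>2 \<ge> 2 / \<epsilon> \<and> ln (ln (X x)) \<ge> 4 / d) at_top"
    by (rule eventually_compose_filterlim[OF eventually_mono X]) auto
  show "eventually (\<lambda>x. norm (real (card {n. 1 \<le> n \<and> real n \<le> x \<and> \<not> \<delta> n \<ge> 2})) \<le> \<epsilon> * norm x) at_top"
    using ev eventually_ge_at_top[of "max 1 (2 * real N / \<epsilon>)"]
  proof eventually_elim
    case (elim x)
    define L where "L = ln (ln (X x))"
    have L: "L \<ge> 2" "L\<^sup>2 \<ge> 2 / \<epsilon>" "L \<ge> 4 / d" using elim by (auto simp: L_def)
    have x: "x \<ge> 1" "2 * real N \<le> \<epsilon> * x" using elim \<epsilon> by (auto simp: divide_le_eq mult.commute)
    let ?A = "{n. 1 \<le> n \<and> real n \<le> x \<and> \<not> \<delta> n \<ge> 2}"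
    have "?A \<subseteq> {..<N} \<union> Suc ` close_triples S (X x) L"
    proof
      fix n assume n: "n \<in> ?A"
      show "n \<in> {..<N} \<union> Suc ` close_triples S (X x) L"
      proof (cases "n < N")
        case False
        then have n3: "n \<ge> 3" "n \<ge> N0" by (auto simp: N_def)
        have "d * min (half_gap S n) (ln (ln (real n)) powr \<iota>) < 2"
          using \<delta>_ge[OF n3(1)] n by auto
        then have "min (half_gap S n) (ln (ln (real n)) powr \<iota>) < 2 / d"
          using d by (simp add: less_divide_eq mult.commute)
        then have "half_gap S n < 2 / d" using N0[OF n3(2)] by (auto simp: min_def split: if_splits)
        moreover define j where "j = n - 1"
        then have j: "n = j + 1" "j \<ge> 1" using n3 by auto
        moreover have "4 / d = 2 * (2 / d)" by simp
        ultimately have "s (j + 2) - s j \<le> 4 / d"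
          using half_gap_eq[OF j(2)] by simp
        moreover have "s j \<le> X x"
          unfolding X_def using n j by (intro s_mono) (simp add: le_nat_floor)
        ultimately have "j \<in> close_triples S (X x) L"
          using j L(3) by (auto simp: close_triples_def)
        moreover have "n = Suc j" using j by simp
        ultimately show ?thesis by blast
      qed auto
    qed
    then have "card ?A \<le> card ({..<N} \<union> Suc ` close_triples S (X x) L)"
      by (intro card_mono) (auto simp: finite_close_triples)
    also have "\<dots> \<le> card {..<N} + card (Suc ` close_triples S (X x) L)" by (rule card_Un_le)
    also have "\<dots> = N + card (close_triples S (X x) L)" by (simp add: card_image)
    finally have "real (card ?A) \<le> real N + real (card (close_triples S (X x) L))" by linarith
    also have "real (card (close_triples S (X x) L)) \<le> counting S (X x) / L\<^sup>2"
      using elim by (simp add: L_def)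
    also have "\<dots> \<le> x / (2 / \<epsilon>)"
    proof (rule frac_le)
      have "indices_upto S (X x) \<subseteq> {1..nat \<lfloor>x\<rfloor>}"
      proof
        fix k assume k: "k \<in> indices_upto S (X x)"
        show "k \<in> {1..nat \<lfloor>x\<rfloor>}"
        proof (rule ccontr)
          assume "k \<notin> {1..nat \<lfloor>x\<rfloor>}"
          then have "nat \<lfloor>x\<rfloor> < k" "1 \<le> nat \<lfloor>x\<rfloor>" using k x by (auto simp: indices_upto_def le_nat_floor)
          then have "enumerate S (nat \<lfloor>x\<rfloor> - 1) < enumerate S (k - 1)" by (intro enumerate_less) auto
          then show False using k by (simp add: indices_upto_def X_def nth_element_def)
        qed
      qed
      then have "card (indices_upto S (X x)) \<le> nat \<lfloor>x\<rfloor>"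
        using card_mono[of "{1..nat \<lfloor>x\<rfloor>}"] by fastforce
      then have "real (card (indices_upto S (X x))) \<le> x" using x by linarith
      then show "counting S (X x) \<le> x" using card_indices_upto(1)[of "X x"] by linarith
    qed (use L \<epsilon> x in auto)
    finally have "real (card ?A) \<le> real N + x / (2 / \<epsilon>)" by simp
    also have "\<dots> \<le> \<epsilon> * x" using x by (simp add: mult.commute)
    finally show ?case using x by simp
  qed
qed

text \<open>
  The exponent \<open>min 1 \<iota>\<close> covers both branches of the minimum in the hypothesis on \<open>\<delta>\<close>: a wide gap
  contributes \<open>L / 2\<close> to the power 1, the other branch \<open>L / 2\<close> to the power \<open>\<iota>\<close>.
\<close>
lemma \<delta>_lower_on_wide_gap:
  assumes L: "L \<ge> 2" "L / 2 \<le> ln (ln (real n))" and n: "n \<ge> 3" and gap: "L / 2 \<le> half_gap S n"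
  shows "d * (L / 2) powr (min 1 \<iota>) \<le> \<delta> n"
proof -
  have "(L / 2) powr (min 1 \<iota>) \<le> (L / 2) powr 1" using L by (intro powr_mono) auto
  then have "(L / 2) powr (min 1 \<iota>) \<le> half_gap S n" using gap L by simp
  moreover have "(L / 2) powr (min 1 \<iota>) \<le> (L / 2) powr \<iota>" using L by (intro powr_mono) auto
  moreover have "(L / 2) powr \<iota> \<le> ln (ln (real n)) powr \<iota>" using L \<iota> by (intro powr_mono2) auto
  ultimately have "d * (L / 2) powr (min 1 \<iota>) \<le> d * min (half_gap S n) (ln (ln (real n)) powr \<iota>)"
    using d by (intro mult_left_mono) auto
  then show ?thesis using \<delta>_ge[OF n] by linarith
qed

text \<open>
  The length \<open>l\<close> is chosen with \<open>l * min 1 \<iota> \<ge> 2\<close>, so that a product over wide gaps is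
  \<open>O((ln (ln x)) powr (-2))\<close>.  The other indices are those below \<open>sqrt x\<close>, where \<open>ln (ln k)\<close> may be
  much smaller than \<open>ln (ln x)\<close>, and those within \<open>l\<close> of a narrow gap.
\<close>
lemma \<delta>_products_smallo:
  "\<exists>l::nat. l \<ge> 1 \<and> (\<lambda>x. \<Sum>k | 1 \<le> k \<and> nth_element S k \<le> x. \<Prod>i = 0..<l. inverse (\<delta> (k + i)))
      \<in> o[at_top](\<lambda>x. counting S x / ln (mean_spacing S x))"
proof -
  define l where "l = nat \<lceil>2 / min 1 \<iota>\<rceil>"
  have "2 / min 1 \<iota> \<le> real l" "2 / min 1 \<iota> > 0" using \<iota> unfolding l_def by (linarith, simp)
  then have l: "l \<ge> 1" "2 \<le> min 1 \<iota> * real l" using \<iota> by (auto simp: divide_le_eq mult.commute Suc_le_eq intro!: gr0I)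
  obtain w where w: "w > 0" "\<And>n. n \<ge> 1 \<Longrightarrow> w \<le> \<delta> n" using \<delta>_bounded_below by blast
  define D where "D = (1 / w) ^ l"
  define E where "E = 4 * (1 / d) ^ l"
  have DE: "D > 0" "E > 0" using w d by (simp_all add: D_def E_def)
  define p where "p k = (\<Prod>i = 0..<l. inverse (\<delta> (k + i)))" for k
  have p_nonneg: "0 \<le> p k" if "k \<ge> 1" for k
    unfolding p_def using \<delta>_pos that by (intro prod_nonneg) (auto simp: less_imp_le)
  have p_le_D: "p k \<le> D" if "k \<ge> 1" for k
  proof -
    have "p k \<le> (\<Prod>i = 0..<l. 1 / w)"
      unfolding p_def
    proof (intro prod_mono conjI)
      fix i
      have "w \<le> \<delta> (k + i)" using w that by simp
      then show "inverse (\<delta> (k + i)) \<le> 1 / w" "0 \<le> inverse (\<delta> (k + i))"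
        using w(1) by (auto simp: inverse_eq_divide intro!: divide_left_mono)
    qed
    then show ?thesis by (simp add: D_def)
  qed
  have "eventually (\<lambda>x. \<bar>\<Sum>k\<in>indices_upto S x. p k\<bar> \<le> (D * (1 + real l * (1 + real l)) + 2 * E) * counting S x / (ln (ln x))\<^sup>2) at_top"
    using eventually_few_close_triples eventually_gt_at_top[of 4]
  proof eventually_elim
    case (elim x)
    define L where "L = ln (ln x)"
    define V where "V = counting S x / L\<^sup>2"
    define K where "K = indices_upto S x"
    define m where "m = card K"
    have K: "K = {1..m}" "finite K" unfolding K_def m_def by (rule indices_upto_eq, rule finite_indices_upto)
    have L: "L \<ge> 2" using elim by (simp add: L_def)
    have sq: "2 \<le> sqrt x" using elim by (simp add: real_le_rsqrt)
    have V: "sqrt x \<le> V" "real (card (close_triples S x L)) \<le> V" using elim by (auto simp: V_def L_def)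
    \<comment> \<open>Small indices, narrow gaps, and the rest, where every factor is large.\<close>
    define A1 where "A1 = {k \<in> K. real k \<le> sqrt x}"
    define A2 where "A2 i = {k \<in> K. real k > sqrt x \<and> half_gap S (k + i) < L / 2}" for i
    define A3 where "A3 = {k \<in> K. real k > sqrt x \<and> (\<forall>i<l. L / 2 \<le> half_gap S (k + i))}"
    have cover: "K = (A1 \<union> (\<Union>i<l. A2 i)) \<union> A3" by (auto simp: A1_def A2_def A3_def not_le)
    have K1: "k \<ge> 1" if "k \<in> K" for k using that K by simp
    have "card A1 \<le> card {1..nat \<lfloor>sqrt x\<rfloor>}"
      by (intro card_mono) (auto simp: A1_def K(1) le_nat_floor)
    then have A1: "real (card A1) \<le> V" using V(1) sq by (simp add: le_nat_floor) linarith
    have A2: "real (card (A2 i)) \<le> V + real l" if i: "i < l" for i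
    proof -
      have "card (A2 i) \<le> card (close_triples S x L \<union> {m<..m + l})"
      proof (rule card_inj_on_le)
        show "inj_on (\<lambda>k. k + i - 1) (A2 i)"
          by (rule inj_onI) (use K1 in \<open>auto simp: A2_def dest!: K1\<close>)
        show "(\<lambda>k. k + i - 1) ` A2 i \<subseteq> close_triples S x L \<union> {m<..m + l}"
        proof (rule image_subsetI)
          fix k assume k: "k \<in> A2 i"
          \<comment> \<open>The narrow gap starts at \<open>j\<close>, which may lie up to \<open>l\<close> beyond the last index \<open>m\<close>.\<close>
          define j where "j = k + i - 1"
          have k2: "k \<ge> 2" "k \<le> m" "half_gap S (k + i) < L / 2" using k sq K(1) by (auto simp: A2_def)
          have j: "j \<ge> 1" "k + i = j + 1" "j \<le> m + l" using k2 i by (auto simp: j_def)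
          have gap: "s (j + 2) - s j \<le> L" using k2(3) half_gap_eq[OF j(1)] unfolding j(2) by simp
          have "j \<in> close_triples S x L" if "j \<le> m"
          proof -
            have "j \<in> K" using that j K(1) by simp
            then show ?thesis using gap by (simp add: K_def indices_upto_def close_triples_def)
          qed
          then show "k + i - 1 \<in> close_triples S x L \<union> {m<..m + l}"
            unfolding j_def[symmetric] using j by (cases "j \<le> m") auto
        qed
      qed (simp add: finite_close_triples)
      also have "\<dots> \<le> card (close_triples S x L) + card {m<..m + l}" by (rule card_Un_le)
      finally show ?thesis using V(2) by simp
    qed
    have finA: "finite A1" "finite (A2 i)" "finite A3" for i
      using K(2) by (auto simp: A1_def A2_def A3_def)
    have "card (A1 \<union> (\<Union>i<l. A2 i)) \<le> card A1 + card (\<Union>i<l. A2 i)" by (rule card_Un_le)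
    also have "card (\<Union>i<l. A2 i) \<le> (\<Sum>i<l. card (A2 i))" by (rule card_UN_le) simp
    finally have "card (A1 \<union> (\<Union>i<l. A2 i)) \<le> card A1 + (\<Sum>i<l. card (A2 i))" by simp
    then have "real (card (A1 \<union> (\<Union>i<l. A2 i))) \<le> real (card A1 + (\<Sum>i<l. card (A2 i)))" by (rule of_nat_mono)
    then have "real (card (A1 \<union> (\<Union>i<l. A2 i))) \<le> real (card A1) + (\<Sum>i<l. real (card (A2 i)))" by simp
    also have "\<dots> \<le> V + (\<Sum>i<l. V + real l)" using A1 A2 by (intro add_mono sum_mono) auto
    also have "\<dots> = V + real l * (V + real l)" by simp
    also have "\<dots> \<le> V + real l * (V + real l * V)"
      using V(1) sq by (intro add_left_mono mult_left_mono) (auto simp: mult_le_cancel_left1)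
    also have "\<dots> = (1 + real l * (1 + real l)) * V" by (simp add: algebra_simps)
    finally have card12: "real (card (A1 \<union> (\<Union>i<l. A2 i))) \<le> (1 + real l * (1 + real l)) * V" .
    have "(\<Sum>k\<in>A1 \<union> (\<Union>i<l. A2 i). p k) \<le> real (card (A1 \<union> (\<Union>i<l. A2 i))) * D"
      by (rule sum_bounded_above) (use p_le_D K1 cover in blast)
    also have "\<dots> \<le> ((1 + real l * (1 + real l)) * V) * D" using card12 DE by (intro mult_right_mono) auto
    finally have sum12: "(\<Sum>k\<in>A1 \<union> (\<Union>i<l. A2 i). p k) \<le> D * (1 + real l * (1 + real l)) * V" by (simp add: mult_ac)
    have p3: "p k \<le> E / L\<^sup>2" if k: "k \<in> A3" for k
    proof -
      define \<mu> where "\<mu> = (L / 2) powr (min 1 \<iota>)"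
      have \<mu>: "\<mu> > 0" using L by (simp add: \<mu>_def)
      have ks: "real k > sqrt x" using k by (simp add: A3_def)
      have k3: "k \<ge> 3" using ks sq by linarith
      have lnx: "ln x > 1"
      proof (rule ccontr)
        assume "\<not> ln x > 1"
        moreover have "ln x > 0" using elim by simp
        ultimately have "ln (ln x) \<le> ln 1" by (intro ln_mono) auto
        then show False using L by (simp add: L_def)
      qed
      have half: "ln (sqrt x) = ln x / 2" using elim by (simp add: ln_sqrt)
      have eq: "ln (ln (sqrt x)) = L - ln 2" unfolding half using lnx by (simp add: L_def ln_div)
      have ll: "L / 2 \<le> ln (ln (real (k + i)))" for i
      proof -
        have "ln (sqrt x) \<le> ln (real (k + i))" using ks elim by (intro ln_mono) auto
        moreover have "0 < ln (sqrt x)" unfolding half using lnx by simp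
        ultimately have "ln (ln (sqrt x)) \<le> ln (ln (real (k + i)))" by (rule ln_mono)
        then show ?thesis using eq L ln_2_less_1 by linarith
      qed
      have "p k \<le> (\<Prod>i = 0..<l. 1 / (d * \<mu>))"
        unfolding p_def
      proof (intro prod_mono conjI)
        fix i assume "i \<in> {0..<l}"
        then have "d * \<mu> \<le> \<delta> (k + i)"
          unfolding \<mu>_def using k k3 L ll by (intro \<delta>_lower_on_wide_gap) (auto simp: A3_def)
        moreover have "0 < d * \<mu>" using d \<mu> by simp
        ultimately show "inverse (\<delta> (k + i)) \<le> 1 / (d * \<mu>)" "0 \<le> inverse (\<delta> (k + i))"
          by (auto simp: inverse_eq_divide intro!: divide_left_mono)
      qed
      also have "\<dots> = (1 / d) ^ l / \<mu> ^ l" by (simp add: power_divide power_mult_distrib)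
      also have "\<dots> \<le> (1 / d) ^ l / (L / 2)\<^sup>2"
      proof (intro divide_left_mono)
        have "(L / 2) powr 2 \<le> (L / 2) powr (min 1 \<iota> * real l)" using L l by (intro powr_mono) auto
        also have "\<dots> = \<mu> ^ l" using L by (simp add: \<mu>_def powr_powr[symmetric] powr_realpow)
        finally show "(L / 2)\<^sup>2 \<le> \<mu> ^ l" using L by simp
      qed (use d L \<mu> in auto)
      also have "\<dots> = E / L\<^sup>2" by (simp add: E_def power_divide)
      finally show ?thesis .
    qed
    have "1 \<le> V" using V(1) sq by linarith
    moreover have "V \<le> counting S x"
    proof -
      have "1 \<le> L\<^sup>2" using L by (simp add: one_le_power)
      then show ?thesis unfolding V_def using elim by (simp add: divide_le_eq mult_le_cancel_left1)
    qed
    ultimately have C1: "1 \<le> counting S x" by linarith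
    have "(\<Sum>k\<in>A3. p k) \<le> real (card A3) * (E / L\<^sup>2)" by (rule sum_bounded_above) (rule p3)
    also have "\<dots> \<le> (2 * counting S x) * (E / L\<^sup>2)"
    proof (rule mult_right_mono)
      have "card A3 \<le> card K" using K(2) by (intro card_mono) (auto simp: A3_def)
      then show "real (card A3) \<le> 2 * counting S x"
        using card_indices_upto(2)[of x] C1 unfolding K_def by linarith
    qed (use DE in auto)
    also have "\<dots> = 2 * E * V" by (simp add: V_def)
    finally have sum3: "(\<Sum>k\<in>A3. p k) \<le> 2 * E * V" .
    have "(\<Sum>k\<in>K. p k) = (\<Sum>k\<in>A1 \<union> (\<Union>i<l. A2 i). p k) + (\<Sum>k\<in>A3. p k)"
      by (subst cover, rule sum.union_disjoint) (use finA in \<open>auto simp: A1_def A2_def A3_def\<close>)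
    also have "\<dots> \<le> (D * (1 + real l * (1 + real l)) + 2 * E) * V"
      using sum12 sum3 by (simp add: algebra_simps)
    finally have "(\<Sum>k\<in>K. p k) \<le> (D * (1 + real l * (1 + real l)) + 2 * E) * counting S x / L\<^sup>2"
      by (simp add: V_def)
    moreover have "0 \<le> (\<Sum>k\<in>K. p k)" using p_nonneg K1 by (intro sum_nonneg) auto
    ultimately show ?case unfolding K_def L_def by simp
  qed
  from smallo_counting_over_ln_mean_spacing[OF this] l(1) show ?thesis
    unfolding p_def indices_upto_def by blast
qed

end

end

lemma sieved_set_primes_or_squares:
  assumes "S = primes \<or> S = sums_of_two_squares"
  shows "\<exists>c. sieved_set S c"
  using assms primes_avoid_exact_division sums_of_two_squares_avoid_exact_division
    primes_lower_bound sums_of_two_squares_lower_bound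
  unfolding sieved_set_def by blast

theorem theorem4:
  fixes S :: "nat set"
  assumes "S = primes \<or> S = sums_of_two_squares"
  shows "filterlim (mean_spacing S) at_top at_top
    \<and> (\<forall>h :: real.
         (\<lambda>x :: real. real (card {k. 1 \<le> k \<and> nth_element S k \<le> x
                                  \<and> nth_element S (k + 2) - nth_element S k \<le> h}))
           \<in> o[at_top](\<lambda>x. counting S x / ln (mean_spacing S x)))
    \<and> (\<forall>(\<iota> :: real) (\<delta> :: nat \<Rightarrow> real).
         \<iota> > 0
         \<and> (\<forall>n\<ge>1. \<delta> n > 0)
         \<and> (\<forall>n\<ge>2. \<delta> n \<le> half_gap S n)
         \<and> (\<exists>c>0. \<forall>n\<ge>3. \<delta> n \<ge> c * min (half_gap S n) (ln (ln (real n)) powr \<iota>))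
         \<longrightarrow>
           (\<lambda>x :: real. real (card {n :: nat. 1 \<le> n \<and> real n \<le> x \<and> \<not> \<delta> n \<ge> 2}))
             \<in> o[at_top](\<lambda>x. x)
         \<and> (\<exists>l :: nat. l \<ge> 1 \<and>
              (\<lambda>x :: real. \<Sum>k | 1 \<le> k \<and> nth_element S k \<le> x. \<Prod>i = 0..<l. inverse (\<delta> (k + i)))
                \<in> o[at_top](\<lambda>x. counting S x / ln (mean_spacing S x)))
         \<and> (\<exists>c>0. \<forall>n\<ge>2. c \<le> \<delta> n \<and> \<delta> n \<le> half_gap S n))"
proof -
  obtain c where "sieved_set S c" using sieved_set_primes_or_squares[OF assms] by blast
  then interpret sieved_set S c .
  show ?thesis
  proof (intro conjI allI impI)
    show "filterlim (mean_spacing S) at_top at_top" by (rule mean_spacing_tendsto)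
  next
    fix h :: real
    show "(\<lambda>x :: real. real (card {k. 1 \<le> k \<and> nth_element S k \<le> x
            \<and> nth_element S (k + 2) - nth_element S k \<le> h}))
          \<in> o[at_top](\<lambda>x. counting S x / ln (mean_spacing S x))"
      using close_triples_smallo[of h] unfolding close_triples_def .
  next
    fix \<iota> :: real and \<delta> :: "nat \<Rightarrow> real"
    assume *: "\<iota> > 0
         \<and> (\<forall>n\<ge>1. \<delta> n > 0)
         \<and> (\<forall>n\<ge>2. \<delta> n \<le> half_gap S n)
         \<and> (\<exists>c>0. \<forall>n\<ge>3. \<delta> n \<ge> c * min (half_gap S n) (ln (ln (real n)) powr \<iota>))"
    then obtain d where d: "d > 0" "\<And>n. n \<ge> 3 \<Longrightarrow> \<delta> n \<ge> d * min (half_gap S n) (ln (ln (real n)) powr \<iota>)"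
      by blast
    have \<iota>: "\<iota> > 0" and \<delta>: "\<And>n. n \<ge> 1 \<Longrightarrow> \<delta> n > 0" using * by auto
    show "(\<lambda>x :: real. real (card {n :: nat. 1 \<le> n \<and> real n \<le> x \<and> \<not> \<delta> n \<ge> 2})) \<in> o[at_top](\<lambda>x. x)"
      by (rule \<delta>_small_rare[OF \<iota> \<delta> d])
    show "\<exists>l :: nat. l \<ge> 1 \<and>
        (\<lambda>x :: real. \<Sum>k | 1 \<le> k \<and> nth_element S k \<le> x. \<Prod>i = 0..<l. inverse (\<delta> (k + i)))
          \<in> o[at_top](\<lambda>x. counting S x / ln (mean_spacing S x))"
      by (rule \<delta>_products_smallo[OF \<iota> \<delta> d])
    show "\<exists>c>0. \<forall>n\<ge>2. c \<le> \<delta> n \<and> \<delta> n \<le> half_gap S n"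
    proof -
      obtain w where w: "w > 0" "\<And>n. n \<ge> 1 \<Longrightarrow> w \<le> \<delta> n" using \<delta>_bounded_below[OF \<iota> \<delta> d] by blast
      have "w \<le> \<delta> n \<and> \<delta> n \<le> half_gap S n" if "n \<ge> 2" for n using w(2)[of n] * that by simp
      then show ?thesis using w(1) by blast
    qed
  qed
qed

end
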